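(* For every integer $k\geq 3$, there is some $\alpha^{(k)}\in[0,1)$ such that all of the following hold: (1) There is a sequence of $k$-graphs $\{F_n\}_{n\in\mathbb{N}}$ such that $\lim_{n\to\infty}\pi(F_n)=\alpha^{(k)}$ and $\pi(F_n)<\alpha^{(k)}$ for all $n\in\mathbb{N}$. (2) There are $k$-graphs $G_\varepsilon$, one for every real $\varepsilon>0$, such that $\alpha^{(k)}\leq \pi(G_\varepsilon)\leq \alpha^{(k)}+\varepsilon$ for every $\varepsilon>0$ and, moreover, $\pi(\{G_{1/n}\}_{n\in\mathbb{N}})=\alpha^{(k)}$. (3) $\alpha^{(k)}\leq \frac{k-2}{k-1}$, and $\alpha^{(3)}=1/2$ (that is, for $k=3$ the value is $\alpha^{(3)}=1/2$).
   Context: Here $\mathbb{N}=\{1,2,3,\dots\}$. For $k\in\mathbb{N}$, a $k$-uniform hypergraph (or $k$-graph) $H=(V,E)$ consists of a (finite) vertex set $V$ and an edge set $E\subseteq V^{(k)}=\{e\subseteq V: |e|=k\}$. A $k$-graph $H$ contains a copy of a $k$-graph $F$ if there is an injective map $V(F)\to V(H)$ sending every edge of $F$ to an edge of $H$ (i.e. $F$ is isomorphic to a not necessarily induced subhypergraph of $H$). Given $n\in\mathbb{N}$ and a $k$-graph $F$, the extremal number $\mathrm{ex}(n,F)$ is the maximum number of edges in a $k$-graph with $n$ vertices that does not contain a copy of $F$. The Turán density of $F$ is $$\pi(F)=\lim_{n\to\infty}\frac{\mathrm{ex}(n,F)}{\binom{n}{k}},$$ where the limit is known to exist. Likewise, for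 a (possibly infinite) family $\mathcal{F}$ of $k$-graphs, $\mathrm{ex}(n,\mathcal{F})$ is the maximum number of edges in a $k$-graph with $n$ vertices that contains no copy of any member of $\mathcal{F}$, and $\pi(\mathcal{F})=\lim_{n\to\infty}\mathrm{ex}(n,\mathcal{F})/\binom{n}{k}$. *)

theory Defs
  imports Complex_Main
begin

datatype 'a hypergraph = Hypergraph (verts: "'a set") (edges: "'a set set")

definition kgraph :: "nat \<Rightarrow> 'a hypergraph \<Rightarrow> bool" where
  "kgraph k H \<longleftrightarrow> finite (verts H) \<and> edges H \<subseteq> {e. e \<subseteq> verts H \<and> card e = k}"

definition contains_copy :: "'a hypergraph \<Rightarrow> 'b hypergraph \<Rightarrow> bool" where
  "contains_copy H F \<longleftrightarrow>
     (\<exists>f. inj_on f (verts F) \<and> f ` verts F \<subseteq> verts H \<and> (\<forall>e \<in> edges F. f ` e \<in> edges H))"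

text \<open>
  The uniformity \<open>k\<close> is an explicit argument since it is not determined by an edgeless
  forbidden hypergraph. Host hypergraphs range over all finite vertex sets of natural numbers,
  which covers every \<open>k\<close>-graph up to isomorphism. The edge counts are bounded by
  \<open>n choose k\<close>, so \<open>Sup\<close> is their maximum; when no host qualifies (only possible if some
  forbidden hypergraph is edgeless) it is \<open>0\<close>, as \<open>Sup {} = 0\<close> on \<open>nat\<close>.
\<close>

definition ex_family :: "nat \<Rightarrow> nat \<Rightarrow> 'a hypergraph set \<Rightarrow> nat" where
  "ex_family k n \<F> =
     Sup {card (edges H) | H :: nat hypergraph.
            kgraph k H \<and> card (verts H) = n \<and> (\<forall>F \<in> \<F>. \<not> contains_copy H F)}"

definition turan_density_family :: "nat \<Rightarrow> 'a hypergraph set \<Rightarrow> real" where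
  "turan_density_family k \<F> = lim (\<lambda>n. real (ex_family k n \<F>) / real (n choose k))"

definition turan_density :: "nat \<Rightarrow> 'a hypergraph \<Rightarrow> real" where
  "turan_density k F = turan_density_family k {F}"

end

theory Submission
  imports Defs "HOL-Library.FuncSet" "HOL-Library.Nat_Bijection"
begin

text \<open>
  The value is \<open>\<alpha> = 1/2\<close> for every \<open>k\<close>. Call a \<open>(k-1)\<close>-tuple \<open>y\<close> a common predecessor of two vertices
  if each of them forms an edge with \<open>y\<close>. A \<open>k\<close>-graph is \<open>n\<close>-deep if some tuple roots a tree of height
  \<open>n\<close> in which every two entries of a tuple have a common predecessor as a child.

  If every link contains more than half of all tuples, any two vertices have a common predecessor,
  so density above \<open>1/2\<close> gives unbounded depth. On the other hand, colour the vertices \<open>0,\<dots>,N-1\<close>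
  with two colours and take the \<open>k\<close>-sets whose two largest elements get different colours: on average
  half of all \<open>k\<close>-sets are edges, but the second largest element of a tuple shows that the depth is
  at most \<open>2N+1\<close>. Finally, by a stability argument, depth \<open>n\<close> is already forced by density
  \<open>1/2 - \<eta>\<close> for some \<open>\<eta> > 0\<close> depending on \<open>n\<close>: otherwise, many pairs of vertices have almost
  complementary links, and these produce two vertex sets feeding each other.

  Depth passes to products and along homomorphisms, so the product of all dense \<open>k\<close>-graphs on \<open>M\<close>
  vertices is a single forbidden \<open>k\<close>-graph which is still deep; by supersaturation every dense host
  contains it. With density \<open>1/2 - \<eta>\<close> this gives \<open>F\<^sub>n\<close>, with density \<open>1/2 + \<epsilon>\<close> it gives \<open>G\<^sub>\<epsilon>\<close>.
\<close>

section \<open>Trees of common predecessors\<close>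

text \<open>A tuple is a total function of which only the values below \<open>k - 1\<close> count.
  Its entries may repeat at the root; below the root, the \<open>k\<close> elements of an edge made
  of \<open>x i\<close> and the entries of \<open>y\<close> force the entries of \<open>y\<close> to
  be distinct whenever \<open>H\<close> is a \<open>k\<close>-graph.\<close>

fun lev :: "nat \<Rightarrow> 'a hypergraph \<Rightarrow> nat \<Rightarrow> (nat \<Rightarrow> 'a) \<Rightarrow> bool" where
  "lev k H 0 x = True"
| "lev k H (Suc n) x = (\<forall>i j. i < j \<and> j < k - 1 \<longrightarrow>
     (\<exists>y. insert (x i) (y ` {..<k - 1}) \<in> edges H \<and> insert (x j) (y ` {..<k - 1}) \<in> edges H \<and>
          lev k H n y))"

definition deep :: "nat \<Rightarrow> 'a hypergraph \<Rightarrow> nat \<Rightarrow> bool" where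
  "deep k H n \<longleftrightarrow> (\<exists>x. lev k H n x)"

definition is_hom :: "('a \<Rightarrow> 'b) \<Rightarrow> 'a hypergraph \<Rightarrow> 'b hypergraph \<Rightarrow> bool" where
  "is_hom f G H \<longleftrightarrow> f ` verts G \<subseteq> verts H \<and> (\<forall>e\<in>edges G. f ` e \<in> edges H)"

lemma is_hom_comp: "is_hom f G H \<Longrightarrow> is_hom g H K \<Longrightarrow> is_hom (g \<circ> f) G K"
  unfolding is_hom_def image_comp[symmetric] by auto

lemma contains_copy_iff: "contains_copy H G \<longleftrightarrow> (\<exists>f. is_hom f G H \<and> inj_on f (verts G))"
  unfolding contains_copy_def is_hom_def by auto

text \<open>Edges go to edges even under a non-injective homomorphism, so the image of a tree is
  again a tree. Hence a deep hypergraph has no homomorphism into a shallow one, which is the source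
  of all lower bounds on densities.\<close>

lemma lev_hom:
  assumes "is_hom f G H" "lev k G n x"
  shows "lev k H n (f \<circ> x)"
  using assms(2)
proof (induction n arbitrary: x)
  case (Suc n)
  show ?case
    unfolding lev.simps
  proof (intro allI impI)
    fix i j assume "i < j \<and> j < k - 1"
    then obtain y where y: "insert (x i) (y ` {..<k - 1}) \<in> edges G"
      "insert (x j) (y ` {..<k - 1}) \<in> edges G" "lev k G n y"
      using Suc.prems by auto
    have "f ` insert (x i) (y ` {..<k - 1}) \<in> edges H" "f ` insert (x j) (y ` {..<k - 1}) \<in> edges H"
      using assms(1) y by (auto simp only: is_hom_def)
    then show "\<exists>y. insert ((f \<circ> x) i) (y ` {..<k - 1}) \<in> edges H \<and>
        insert ((f \<circ> x) j) (y ` {..<k - 1}) \<in> edges H \<and> lev k H n y"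
      using Suc.IH[OF y(3)] by (intro exI[of _ "f \<circ> y"]) (simp add: image_image comp_def)
  qed
qed simp

lemma deep_hom: "is_hom f G H \<Longrightarrow> deep k G n \<Longrightarrow> deep k H n"
  unfolding deep_def using lev_hom by blast

lemma lev_Suc_imp_lev: "lev k H (Suc n) x \<Longrightarrow> lev k H n x"
proof (induction n arbitrary: x)
  case (Suc n)
  show ?case
    unfolding lev.simps
  proof (intro allI impI)
    fix i j assume "i < j \<and> j < k - 1"
    then obtain y where "insert (x i) (y ` {..<k - 1}) \<in> edges H"
      "insert (x j) (y ` {..<k - 1}) \<in> edges H" "lev k H (Suc n) y"
      using Suc.prems lev.simps(2)[of k H "Suc n" x] by blast
    with Suc.IH show "\<exists>y. insert (x i) (y ` {..<k - 1}) \<in> edges H \<and>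
        insert (x j) (y ` {..<k - 1}) \<in> edges H \<and> lev k H n y"
      by blast
  qed
qed simp

lemma lev_antimono:
  assumes "lev k H n x" "m \<le> n"
  shows "lev k H m x"
  using assms(2,1) by (induction rule: inc_induct) (simp_all only: lev_Suc_imp_lev)

lemma deep_antimono: "deep k H n \<Longrightarrow> m \<le> n \<Longrightarrow> deep k H m"
  unfolding deep_def using lev_antimono by blast

text \<open>For \<open>k \<ge> 3\<close> a tuple has the two entries 0 and 1, so one level already
  demands an edge. This rules out edgeless forbidden hypergraphs, which the limit lemmas
  exclude.\<close>

lemma deep_imp_edge:
  assumes "deep k H (Suc n)" "k \<ge> 3"
  shows "edges H \<noteq> {}"
proof -
  from assms(1) obtain x where "lev k H (Suc n) x" by (auto simp: deep_def)
  moreover have "(0::nat) < 1 \<and> 1 < k - 1" using assms(2) by simp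
  ultimately obtain y where "insert (x 0) (y ` {..<k - 1}) \<in> edges H"
    unfolding lev.simps by blast
  then show ?thesis by blast
qed

text \<open>Tuples in \<open>A\<close> find predecessors in \<open>B\<close> and conversely, so
  alternating between the two sets gives trees of every height; both claims go through one
  induction. The choice \<open>A = B\<close> describes a set feeding itself.\<close>

lemma deep_if_mutual:
  assumes "A \<noteq> {}" "K = k - 1"
    and A: "\<And>v w. v \<in> A \<Longrightarrow> w \<in> A \<Longrightarrow> \<exists>y \<in> {..<K} \<rightarrow> B.
        insert v (y ` {..<K}) \<in> edges H \<and> insert w (y ` {..<K}) \<in> edges H"
    and B: "\<And>v w. v \<in> B \<Longrightarrow> w \<in> B \<Longrightarrow> \<exists>y \<in> {..<K} \<rightarrow> A.
        insert v (y ` {..<K}) \<in> edges H \<and> insert w (y ` {..<K}) \<in> edges H"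
  shows "deep k H n"
proof -
  have "(x \<in> {..<K} \<rightarrow> A \<longrightarrow> lev k H n x) \<and> (x \<in> {..<K} \<rightarrow> B \<longrightarrow> lev k H n x)" for x
  proof (induction n arbitrary: x)
    case (Suc n)
    show ?case
    proof (intro conjI impI)
      assume x: "x \<in> {..<K} \<rightarrow> A"
      show "lev k H (Suc n) x" unfolding lev.simps assms(2)[symmetric]
      proof (intro allI impI)
        fix i j assume "i < j \<and> j < K"
        then have "x i \<in> A" "x j \<in> A" using x by auto
        from A[OF this] obtain y where y: "y \<in> {..<K} \<rightarrow> B"
          "insert (x i) (y ` {..<K}) \<in> edges H \<and> insert (x j) (y ` {..<K}) \<in> edges H"
          by blast
        moreover from Suc y(1) have "lev k H n y" by simp
        ultimately show "\<exists>y. insert (x i) (y ` {..<K}) \<in> edges H \<and>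
          insert (x j) (y ` {..<K}) \<in> edges H \<and> lev k H n y" by (intro exI[of _ y]) simp
      qed
    next
      assume x: "x \<in> {..<K} \<rightarrow> B"
      show "lev k H (Suc n) x" unfolding lev.simps assms(2)[symmetric]
      proof (intro allI impI)
        fix i j assume "i < j \<and> j < K"
        then have "x i \<in> B" "x j \<in> B" using x by auto
        from B[OF this] obtain y where y: "y \<in> {..<K} \<rightarrow> A"
          "insert (x i) (y ` {..<K}) \<in> edges H \<and> insert (x j) (y ` {..<K}) \<in> edges H"
          by blast
        moreover from Suc y(1) have "lev k H n y" by simp
        ultimately show "\<exists>y. insert (x i) (y ` {..<K}) \<in> edges H \<and>
          insert (x j) (y ` {..<K}) \<in> edges H \<and> lev k H n y" by (intro exI[of _ y]) simp
      qed
    qed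
  qed simp
  moreover from assms(1) obtain a where "a \<in> A" by blast
  ultimately have "lev k H n (\<lambda>_. a)" by auto
  then show ?thesis by (auto simp: deep_def)
qed

section \<open>Categorical products of k-graphs\<close>

definition hprod :: "nat \<Rightarrow> nat hypergraph \<Rightarrow> nat hypergraph \<Rightarrow> nat hypergraph" where
  "hprod k G H = Hypergraph (prod_encode ` (verts G \<times> verts H))
     {e. e \<subseteq> prod_encode ` (verts G \<times> verts H) \<and> card e = k \<and>
         (fst \<circ> prod_decode) ` e \<in> edges G \<and> (snd \<circ> prod_decode) ` e \<in> edges H}"

lemma is_hom_hprod:
  "is_hom (fst \<circ> prod_decode) (hprod k G H) G" "is_hom (snd \<circ> prod_decode) (hprod k G H) H"
  unfolding is_hom_def hprod_def by auto

lemma kgraph_hprod: "kgraph k G \<Longrightarrow> kgraph k H \<Longrightarrow> kgraph k (hprod k G H)"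
  unfolding kgraph_def hprod_def by auto

lemma hprod_edge:
  assumes "kgraph k G" "kgraph k H" "k \<ge> 1"
    and e: "insert u (y ` {..<k - 1}) \<in> edges G" "insert v (z ` {..<k - 1}) \<in> edges H"
  shows "insert (prod_encode (u, v)) ((\<lambda>i. prod_encode (y i, z i)) ` {..<k - 1}) \<in> edges (hprod k G H)"
proof -
  let ?e = "insert (prod_encode (u, v)) ((\<lambda>i. prod_encode (y i, z i)) ` {..<k - 1})"
  have 1: "(fst \<circ> prod_decode) ` ?e = insert u (y ` {..<k - 1})"
    "(snd \<circ> prod_decode) ` ?e = insert v (z ` {..<k - 1})"
    by (simp_all add: image_image)
  \<comment> \<open>The set has at most \<open>k\<close> elements by its form, and at least
    \<open>k\<close> because it projects onto an edge of \<open>G\<close>.\<close>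
  have "card ?e \<le> Suc (card ((\<lambda>i. prod_encode (y i, z i)) ` {..<k - 1}))"
    by (rule card_insert_le_m1) auto
  also have "\<dots> \<le> Suc (card {..<k - 1})"
    by (intro Suc_le_mono[THEN iffD2] card_image_le) auto
  also have "\<dots> = k" using assms(3) by simp
  finally have "card ?e \<le> k" .
  moreover have "card ((fst \<circ> prod_decode) ` ?e) \<le> card ?e"
    by (rule card_image_le) auto
  moreover have "card ((fst \<circ> prod_decode) ` ?e) = k"
    unfolding 1 using assms(1) e(1) by (auto simp: kgraph_def)
  ultimately have 2: "card ?e = k" by simp
  have "insert u (y ` {..<k - 1}) \<subseteq> verts G" "insert v (z ` {..<k - 1}) \<subseteq> verts H"
    using subsetD[OF conjunct2[OF assms(1)[unfolded kgraph_def]] e(1)]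
      subsetD[OF conjunct2[OF assms(2)[unfolded kgraph_def]] e(2)] by simp_all
  then have 3: "?e \<subseteq> prod_encode ` (verts G \<times> verts H)" by auto
  show ?thesis
    unfolding hprod_def hypergraph.sel mem_Collect_eq 1
    by (intro conjI 2 3 e)
qed

lemma deep_hprod:
  assumes "kgraph k G" "kgraph k H" "k \<ge> 1" "deep k G n" "deep k H n"
  shows "deep k (hprod k G H) n"
proof -
  have "lev k (hprod k G H) n (\<lambda>i. prod_encode (x i, y i))" if "lev k G n x" "lev k H n y" for x y
    using that
  proof (induction n arbitrary: x y)
    case (Suc n)
    show ?case
      unfolding lev.simps
    proof (intro allI impI)
      fix i j assume ij: "i < j \<and> j < k - 1"
      obtain x' where x': "insert (x i) (x' ` {..<k - 1}) \<in> edges G"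
        "insert (x j) (x' ` {..<k - 1}) \<in> edges G" "lev k G n x'"
        using Suc.prems(1) ij by auto
      obtain y' where y': "insert (y i) (y' ` {..<k - 1}) \<in> edges H"
        "insert (y j) (y' ` {..<k - 1}) \<in> edges H" "lev k H n y'"
        using Suc.prems(2) ij by auto
      show "\<exists>z. insert (prod_encode (x i, y i)) (z ` {..<k - 1}) \<in> edges (hprod k G H) \<and>
          insert (prod_encode (x j, y j)) (z ` {..<k - 1}) \<in> edges (hprod k G H) \<and>
          lev k (hprod k G H) n z"
        using Suc.IH[OF x'(3) y'(3)] hprod_edge[OF assms(1-3)] x' y' by blast
    qed
  qed simp
  then show ?thesis using assms(4,5) by (auto simp: deep_def)
qed

text \<open>One factor is multiplied in at a time; encoding pairs of vertices as naturals keeps the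
  product in the same type. A single \<open>G\<close> serves all \<open>n\<close> at once, which
  later yields a hypergraph that is deep for every \<open>n\<close>.\<close>

lemma common_hom_source:
  fixes \<C> :: "nat hypergraph set"
  assumes "finite \<C>" "\<C> \<noteq> {}" "k \<ge> 1" "\<And>C. C \<in> \<C> \<Longrightarrow> kgraph k C"
  shows "\<exists>G :: nat hypergraph. kgraph k G \<and> (\<forall>C\<in>\<C>. \<exists>f. is_hom f G C) \<and>
    (\<forall>n. (\<forall>C\<in>\<C>. deep k C n) \<longrightarrow> deep k G n)"
  using assms(1,2,4)
proof (induction rule: finite_ne_induct)
  case (singleton C)
  have "is_hom id C C" by (simp add: is_hom_def)
  with singleton show ?case by blast
next
  case (insert C \<C>)
  then obtain G :: "nat hypergraph" where G: "kgraph k G" "\<forall>C\<in>\<C>. \<exists>f. is_hom f G C"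
    "\<And>n. \<forall>C\<in>\<C>. deep k C n \<Longrightarrow> deep k G n" by auto
  have C: "kgraph k C" using insert.prems by auto
  show ?case
  proof (intro exI[of _ "hprod k C G"] conjI allI impI)
    show "kgraph k (hprod k C G)" using kgraph_hprod C G(1) .
    show "\<forall>D\<in>insert C \<C>. \<exists>f. is_hom f (hprod k C G) D"
      using is_hom_hprod[of k C G] G(2) is_hom_comp by blast
    show "deep k (hprod k C G) n" if "\<forall>C\<in>insert C \<C>. deep k C n" for n
      using deep_hprod[OF C G(1) assms(3)] G(3) that by blast
  qed
qed

section \<open>Counting maps, pullbacks and extremal numbers\<close>

text \<open>Between finite sets of equal size, onto and one-to-one coincide, so the maps counted are
  the injective ones.\<close>

lemma card_bij_PiE:
  assumes "finite I" "finite A" "card A = card I"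
  shows "card {x \<in> I \<rightarrow>\<^sub>E A. x ` I = A} = fact (card I)"
proof -
  have "x ` I = A \<longleftrightarrow> inj_on x I" if "x \<in> I \<rightarrow>\<^sub>E A" for x
  proof
    assume "x ` I = A"
    then show "inj_on x I" using assms eq_card_imp_inj_on by metis
  next
    assume "inj_on x I"
    then have "card (x ` I) = card A" using assms(3) card_image by metis
    moreover have "x ` I \<subseteq> A" using that by auto
    ultimately show "x ` I = A" using assms(2) card_subset_eq by blast
  qed
  then have "{x \<in> I \<rightarrow>\<^sub>E A. x ` I = A} = {x \<in> I \<rightarrow>\<^sub>E A. inj_on x I}"
    by blast
  also have "card \<dots> = prod ((-) (card A)) {0..<card I}"
    using card_inj_on_subset_funcset[OF assms(1,2) subset_refl] by simp
  also have "\<dots> = fact (card I)"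
    unfolding assms(3) fact_prod_rev by simp
  finally show ?thesis .
qed

lemma card_image_in_PiE:
  assumes "finite I" "finite V" "\<And>a. a \<in> \<A> \<Longrightarrow> a \<subseteq> V \<and> card a = card I"
  shows "card {x \<in> I \<rightarrow>\<^sub>E V. x ` I \<in> \<A>} = card \<A> * fact (card I)"
proof -
  have "finite \<A>" using assms(2,3) by (meson Pow_iff finite_Pow_iff finite_subset subsetI)
  have "{x \<in> I \<rightarrow>\<^sub>E V. x ` I \<in> \<A>} = (\<Union>a\<in>\<A>. {x \<in> I \<rightarrow>\<^sub>E a. x ` I = a})"
    using assms(3) by fastforce
  also have "card \<dots> = (\<Sum>a\<in>\<A>. card {x \<in> I \<rightarrow>\<^sub>E a. x ` I = a})"
    using assms \<open>finite \<A>\<close>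
    by (intro card_UN_disjoint ballI) (auto intro!: finite_PiE intro: finite_subset)
  also have "\<dots> = (\<Sum>a\<in>\<A>. fact (card I))"
    using assms by (intro sum.cong refl card_bij_PiE) (auto intro: finite_subset)
  finally show ?thesis by simp
qed

lemma card_PiE_restrict:
  assumes "finite I" "J \<subseteq> I"
  shows "card {x \<in> I \<rightarrow>\<^sub>E V. P (restrict x J)} = card {y \<in> J \<rightarrow>\<^sub>E V. P y} * card V ^ card (I - J)"
proof -
  let ?f = "\<lambda>x. (restrict x J, restrict x (I - J))"
  let ?g = "\<lambda>(y, z) i. if i \<in> J then y i else z i"
  have "bij_betw ?f {x \<in> I \<rightarrow>\<^sub>E V. P (restrict x J)} ({y \<in> J \<rightarrow>\<^sub>E V. P y} \<times> ((I - J) \<rightarrow>\<^sub>E V))"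
  proof (rule bij_betw_byWitness[of _ ?g])
    show "\<forall>x\<in>{x \<in> I \<rightarrow>\<^sub>E V. P (restrict x J)}. ?g (?f x) = x"
      using assms(2) by (auto simp: fun_eq_iff PiE_def extensional_def)
    have r: "restrict (?g (y, z)) J = y" "restrict (?g (y, z)) (I - J) = z" "?g (y, z) \<in> I \<rightarrow>\<^sub>E V"
      if "y \<in> J \<rightarrow>\<^sub>E V" "z \<in> (I - J) \<rightarrow>\<^sub>E V" for y z
      using that assms(2) by (auto simp: fun_eq_iff PiE_def extensional_def Pi_def)
    show "\<forall>p\<in>{y \<in> J \<rightarrow>\<^sub>E V. P y} \<times> ((I - J) \<rightarrow>\<^sub>E V). ?f (?g p) = p"
      by (intro ballI, elim SigmaE, simp only: r mem_Collect_eq)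
    show "?g ` ({y \<in> J \<rightarrow>\<^sub>E V. P y} \<times> ((I - J) \<rightarrow>\<^sub>E V)) \<subseteq> {x \<in> I \<rightarrow>\<^sub>E V. P (restrict x J)}"
      by (intro image_subsetI, elim SigmaE, simp only: r mem_Collect_eq)
    show "?f ` {x \<in> I \<rightarrow>\<^sub>E V. P (restrict x J)} \<subseteq> {y \<in> J \<rightarrow>\<^sub>E V. P y} \<times> ((I - J) \<rightarrow>\<^sub>E V)"
      using assms(2) by auto
  qed
  from bij_betw_same_card[OF this] show ?thesis
    using assms(1) by (simp add: card_cartesian_product card_funcsetE)
qed

text \<open>In a \<open>k\<close>-graph \<open>H\<close> the condition forces \<open>x\<close> to be
  injective on \<open>e\<close>. For random \<open>x\<close> this is sampling with repetition; seen
  from \<open>H\<close> it is a blow-up whose parts are the fibres of \<open>x\<close>.\<close>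

definition pullback :: "nat \<Rightarrow> 'b set \<Rightarrow> ('b \<Rightarrow> 'a) \<Rightarrow> 'a hypergraph \<Rightarrow> 'b hypergraph" where
  "pullback k I x H = Hypergraph I {e. e \<subseteq> I \<and> card e = k \<and> x ` e \<in> edges H}"

lemma kgraph_pullback: "finite I \<Longrightarrow> kgraph k (pullback k I x H)"
  by (auto simp: kgraph_def pullback_def)

lemma is_hom_pullback: "x \<in> I \<rightarrow>\<^sub>E verts H \<Longrightarrow> is_hom x (pullback k I x H) H"
  by (auto simp: is_hom_def pullback_def)

lemma kgraph_edgeD: "kgraph k H \<Longrightarrow> e \<in> edges H \<Longrightarrow> e \<subseteq> verts H \<and> card e = k"
  by (auto simp: kgraph_def)

lemma finite_edges: "kgraph k H \<Longrightarrow> finite (edges H)"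
  by (rule finite_subset[of _ "Pow (verts H)"]) (auto simp: kgraph_def)

lemma card_edges_le: "kgraph k H \<Longrightarrow> card (edges H) \<le> card (verts H) choose k"
  unfolding kgraph_def using card_mono[of "{e. e \<subseteq> verts H \<and> card e = k}" "edges H"]
  by (simp add: n_subsets)

text \<open>Double counting of maps against \<open>k\<close>-subsets of \<open>I\<close>: a subset
  can be mapped onto an edge in \<open>card (edges H) * fact k\<close> ways, and the remaining
  points go anywhere.\<close>

lemma sum_card_edges_pullback:
  assumes "finite I" "kgraph k H"
  shows "(\<Sum>x\<in>I \<rightarrow>\<^sub>E verts H. card (edges (pullback k I x H))) =
    (card I choose k) * (card (edges H) * fact k * card (verts H) ^ (card I - k))"
proof -
  have V: "finite (verts H)" using assms(2) by (simp add: kgraph_def)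
  let ?S = "{e. e \<subseteq> I \<and> card e = k}"
  have S: "finite ?S" by (rule finite_subset[of _ "Pow I"]) (use assms(1) in auto)
  have "(\<Sum>x\<in>I \<rightarrow>\<^sub>E verts H. card (edges (pullback k I x H))) =
    (\<Sum>x\<in>I \<rightarrow>\<^sub>E verts H. card {e \<in> ?S. x ` e \<in> edges H})"
    by (simp add: pullback_def conj_assoc)
  also have "\<dots> = (\<Sum>e\<in>?S. card {x \<in> I \<rightarrow>\<^sub>E verts H. x ` e \<in> edges H})"
    using S V assms(1) by (intro sum_multicount_gen) (auto intro!: finite_PiE)
  also have "\<dots> = (\<Sum>e\<in>?S. card (edges H) * fact k * card (verts H) ^ (card I - k))"
  proof (rule sum.cong[OF refl])
    fix e assume "e \<in> ?S"
    then have e: "e \<subseteq> I" "card e = k" "finite e" using assms(1) finite_subset by auto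
    have "card {x \<in> I \<rightarrow>\<^sub>E verts H. x ` e \<in> edges H} =
        card {x \<in> I \<rightarrow>\<^sub>E verts H. restrict x e ` e \<in> edges H}"
      by simp
    also have "\<dots> = card {y \<in> e \<rightarrow>\<^sub>E verts H. y ` e \<in> edges H} * card (verts H) ^ card (I - e)"
      by (rule card_PiE_restrict[OF assms(1) e(1)])
    also have "card {y \<in> e \<rightarrow>\<^sub>E verts H. y ` e \<in> edges H} = card (edges H) * fact k"
      using card_image_in_PiE[OF e(3) V, of "edges H"] kgraph_edgeD[OF assms(2)] e(2) by auto
    also have "card (I - e) = card I - k"
      using e by (simp add: card_Diff_subset)
    finally show "card {x \<in> I \<rightarrow>\<^sub>E verts H. x ` e \<in> edges H} =
      card (edges H) * fact k * card (verts H) ^ (card I - k)" .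
  qed
  also have "\<dots> = (card I choose k) * (card (edges H) * fact k * card (verts H) ^ (card I - k))"
    using assms(1) by (simp add: n_subsets)
  finally show ?thesis .
qed

section \<open>Extremal numbers: attainment, averaging and convergence\<close>

lemma bdd_above_ex_family:
  "bdd_above {card (edges H) | H :: nat hypergraph.
    kgraph k H \<and> card (verts H) = n \<and> (\<forall>F \<in> \<F>. \<not> contains_copy H F)}"
  by (rule bdd_aboveI[of _ "n choose k"]) (auto intro: card_edges_le)

lemma ex_family_ge:
  fixes H :: "nat hypergraph"
  assumes "kgraph k H" "\<And>F. F \<in> \<F> \<Longrightarrow> \<not> contains_copy H F"
  shows "card (edges H) \<le> ex_family k (card (verts H)) \<F>"
  unfolding ex_family_def using assms by (intro cSup_upper bdd_above_ex_family) auto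

text \<open>\<open>Sup\<close> is a maximum here: edge counts are bounded, and the edgeless host on
  \<open>n\<close> vertices qualifies because every forbidden hypergraph has an edge.\<close>

lemma ex_family_attained:
  assumes "\<And>F. F \<in> \<F> \<Longrightarrow> edges F \<noteq> {}"
  obtains H :: "nat hypergraph" where "kgraph k H" "card (verts H) = n"
    "\<And>F. F \<in> \<F> \<Longrightarrow> \<not> contains_copy H F" "card (edges H) = ex_family k n \<F>"
proof -
  let ?S = "{card (edges H) | H :: nat hypergraph.
    kgraph k H \<and> card (verts H) = n \<and> (\<forall>F \<in> \<F>. \<not> contains_copy H F)}"
  have "kgraph k (Hypergraph {..<n} {}) \<and> card (verts (Hypergraph {..<n} {})) = n \<and>
    (\<forall>F \<in> \<F>. \<not> contains_copy (Hypergraph {..<n} {}) F)"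
    using assms by (auto simp: kgraph_def contains_copy_def)
  then have "?S \<noteq> {}" by blast
  moreover have "finite ?S"
    using bdd_above_ex_family by (simp add: bdd_above_nat)
  ultimately have "Sup ?S \<in> ?S"
    by (simp only: cSup_eq_Max Max_in simp_thms)
  then show ?thesis using that unfolding ex_family_def by auto
qed

lemma ex_family_mono:
  assumes "\<F> \<subseteq> \<G>" "\<And>F. F \<in> \<G> \<Longrightarrow> edges F \<noteq> {}"
  shows "ex_family k n \<G> \<le> ex_family k n \<F>"
proof -
  obtain H :: "nat hypergraph" where H: "kgraph k H" "card (verts H) = n"
    "\<And>F. F \<in> \<G> \<Longrightarrow> \<not> contains_copy H F" "card (edges H) = ex_family k n \<G>"
    using ex_family_attained[OF assms(2)] by blast
  from ex_family_ge[OF H(1), of \<F>] H(2-4) assms(1) show ?thesis by auto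
qed

text \<open>Averaging over the deletion of one vertex (Katona, Nemetz and Simonovits).\<close>

lemma ex_family_Suc:
  fixes \<F> :: "'a hypergraph set"
  assumes "\<And>F. F \<in> \<F> \<Longrightarrow> edges F \<noteq> {}" "k \<le> n"
  shows "(Suc n - k) * ex_family k (Suc n) \<F> \<le> Suc n * ex_family k n \<F>"
proof -
  obtain H :: "nat hypergraph" where H: "kgraph k H" "card (verts H) = Suc n"
    "\<And>F. F \<in> \<F> \<Longrightarrow> \<not> contains_copy H F" "card (edges H) = ex_family k (Suc n) \<F>"
    using ex_family_attained[OF assms(1)] by blast
  have fin: "finite (verts H)" "finite (edges H)" using H(1) finite_edges by (auto simp: kgraph_def)
  have *: "card {e \<in> edges H. v \<notin> e} \<le> ex_family k n \<F>" if v: "v \<in> verts H" for v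
  proof -
    let ?D = "Hypergraph (verts H - {v}) {e \<in> edges H. v \<notin> e}"
    have "contains_copy H F" if "contains_copy ?D F" for F :: "'a hypergraph"
      using that unfolding contains_copy_def by fastforce
    then have "\<not> contains_copy ?D F" if "F \<in> \<F>" for F
      using H(3)[OF that] by blast
    moreover have "kgraph k ?D" using H(1) by (auto simp: kgraph_def)
    moreover have "card (verts ?D) = n" using v fin H(2) by simp
    ultimately show ?thesis using ex_family_ge[of k ?D \<F>] by simp
  qed
  \<comment> \<open>Each edge survives the deletion of exactly the \<open>Suc n - k\<close> vertices
    outside it.\<close>
  have "(\<Sum>v\<in>verts H. card {e \<in> edges H. v \<notin> e}) = (\<Sum>e\<in>edges H. card {v \<in> verts H. v \<notin> e})"
    using fin by (intro sum_multicount_gen) auto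
  also have "\<dots> = (\<Sum>e\<in>edges H. Suc n - k)"
  proof (rule sum.cong[OF refl])
    fix e assume "e \<in> edges H"
    then have "e \<subseteq> verts H" "card e = k" using kgraph_edgeD[OF H(1)] by auto
    moreover have "{v \<in> verts H. v \<notin> e} = verts H - e" by auto
    ultimately show "card {v \<in> verts H. v \<notin> e} = Suc n - k"
      using H(2) fin(1) by (simp add: card_Diff_subset finite_subset)
  qed
  finally have "(Suc n - k) * ex_family k (Suc n) \<F> = (\<Sum>v\<in>verts H. card {e \<in> edges H. v \<notin> e})"
    using H(4) by simp
  also have "\<dots> \<le> (\<Sum>v\<in>verts H. ex_family k n \<F>)"
    by (intro sum_mono *)
  finally show ?thesis using H(2) by simp
qed

abbreviation ex_ratio :: "nat \<Rightarrow> 'a hypergraph set \<Rightarrow> nat \<Rightarrow> real" where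
  "ex_ratio k \<F> n \<equiv> real (ex_family k n \<F>) / real (n choose k)"

lemma ex_ratio_Suc:
  assumes "\<And>F. F \<in> \<F> \<Longrightarrow> edges F \<noteq> {}" "k \<le> n"
  shows "ex_ratio k \<F> (Suc n) \<le> ex_ratio k \<F> n"
proof -
  have "(Suc n - k) * (Suc n choose k) = Suc n * (n choose k)"
    using binomial_absorb_comp[of "Suc n" k] by simp
  then have b: "real (Suc n - k) * real (Suc n choose k) = real (Suc n) * real (n choose k)"
    by (simp only: of_nat_mult[symmetric])
  have e: "real (Suc n - k) * real (ex_family k (Suc n) \<F>) \<le> real (Suc n) * real (ex_family k n \<F>)"
    using ex_family_Suc[OF assms] by (simp only: of_nat_mult[symmetric] of_nat_le_iff)
  have pos: "real (Suc n - k) > 0" "real (n choose k) > 0" "real (Suc n choose k) > 0"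
    using assms(2) by (auto simp: zero_less_binomial_iff)
  have "ex_ratio k \<F> (Suc n) =
    (real (Suc n - k) * real (ex_family k (Suc n) \<F>)) / (real (Suc n - k) * real (Suc n choose k))"
    using pos by simp
  also have "\<dots> \<le> (real (Suc n) * real (ex_family k n \<F>)) / (real (Suc n) * real (n choose k))"
    unfolding b using e pos by (intro divide_right_mono) auto
  also have "\<dots> = ex_ratio k \<F> n" by simp
  finally show ?thesis .
qed

text \<open>\<open>lim\<close> is a mere description, so convergence has to be shown: the ratio
  decreases and is nonnegative. The shift by \<open>k\<close> skips the indices where the binomial
  coefficient is 0 and the quotient is 0 by convention.\<close>

lemma turan_density_family_limit:
  assumes "\<And>F. F \<in> \<F> \<Longrightarrow> edges F \<noteq> {}"
  shows "ex_ratio k \<F> \<longlonglongrightarrow> turan_density_family k \<F>"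
proof -
  have "decseq (\<lambda>n. ex_ratio k \<F> (n + k))"
    using ex_ratio_Suc[OF assms] by (intro decseq_SucI) simp
  then obtain L where "(\<lambda>n. ex_ratio k \<F> (n + k)) \<longlonglongrightarrow> L"
    by (rule decseq_convergent[of _ 0]) auto
  then have "ex_ratio k \<F> \<longlonglongrightarrow> L"
    by (rule LIMSEQ_offset)
  from this limI[OF this] show ?thesis
    unfolding turan_density_family_def by (simp only:)
qed

text \<open>Blow-up bound. A copy of \<open>F\<close> in the pullback along \<open>x\<close> would
  compose with \<open>x\<close> to a homomorphism into \<open>H\<close>. So every pullback to
  \<open>m\<close> points is an admissible host, and the mean of their edge counts is a lower
  bound.\<close>

lemma ex_ratio_ge_if_no_hom:
  fixes H :: "nat hypergraph"
  assumes "kgraph k H" "verts H \<noteq> {}" "\<And>F f. F \<in> \<F> \<Longrightarrow> \<not> is_hom f F H" "k \<le> m"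
  shows "real (card (edges H)) * fact k / real (card (verts H)) ^ k \<le> ex_ratio k \<F> m"
proof -
  let ?N = "card (verts H)" and ?X = "{..<m} \<rightarrow>\<^sub>E verts H"
  have V: "finite (verts H)" "?N > 0" using assms(1,2) by (auto simp: kgraph_def card_gt_0_iff)
  have *: "card (edges (pullback k {..<m} x H)) \<le> ex_family k m \<F>" if "x \<in> ?X" for x
  proof -
    have "\<not> contains_copy (pullback k {..<m} x H) F" if "F \<in> \<F>" for F
      using is_hom_comp[OF _ is_hom_pullback[OF \<open>x \<in> ?X\<close>]] assms(3)[OF that]
      unfolding contains_copy_iff by blast
    from ex_family_ge[OF kgraph_pullback[OF finite_lessThan] this] show ?thesis
      by (simp add: pullback_def)
  qed
  have "(m choose k) * (card (edges H) * fact k * ?N ^ (m - k)) =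
      (\<Sum>x\<in>?X. card (edges (pullback k {..<m} x H)))"
    using sum_card_edges_pullback[OF _ assms(1), of "{..<m}"] by simp
  also have "\<dots> \<le> (\<Sum>x\<in>?X. ex_family k m \<F>)"
    by (intro sum_mono *)
  also have "\<dots> = ?N ^ (m - k) * (?N ^ k * ex_family k m \<F>)"
    using assms(4) by (simp add: card_funcsetE flip: power_add)
  finally have "(m choose k) * (card (edges H) * fact k) \<le> ?N ^ k * ex_family k m \<F>"
    using V(2) by (simp add: algebra_simps)
  then have "real ((m choose k) * (card (edges H) * fact k)) \<le> real (?N ^ k * ex_family k m \<F>)"
    by (simp only: of_nat_le_iff)
  then have "real (m choose k) * (real (card (edges H)) * fact k) \<le> real ?N ^ k * real (ex_family k m \<F>)"
    by simp
  then show ?thesis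
    using V(2) assms(4) by (simp add: field_simps zero_less_binomial_iff)
qed

section \<open>The two-coloured ordered hypergraph\<close>

definition second_max :: "nat set \<Rightarrow> nat" where
  "second_max A = Max (A - {Max A})"

lemma second_max_less:
  assumes "finite A" "card A \<ge> 2"
  shows "second_max A \<in> A" "second_max A < Max A" "Max A \<in> A"
proof -
  have "A \<noteq> {}" using assms(2) by auto
  then show M: "Max A \<in> A" using assms(1) by simp
  have "card (A - {Max A}) \<noteq> 0" using assms M by (simp add: card_Diff_subset)
  then have "A - {Max A} \<noteq> {}" by (metis card.empty)
  then have "second_max A \<in> A - {Max A}"
    unfolding second_max_def using assms(1) by (intro Max_in) auto
  moreover from this show "second_max A \<in> A" by blast
  ultimately show "second_max A < Max A"
    using assms(1) by (metis DiffD2 Max_ge insertI1 order_le_imp_less_or_eq DiffD1)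
qed

lemma
  assumes "finite A" "card A \<ge> 2" "u \<notin> A"
  shows Max_insert_eq: "Max (insert u A) = max u (Max A)"
    and second_max_insert:
      "second_max (insert u A) = (if u > Max A then Max A else max u (second_max A))"
proof -
  have ne: "A \<noteq> {}" using assms(2) by auto
  show M: "Max (insert u A) = max u (Max A)" using ne assms(1) by simp
  have "A - {Max A} \<noteq> {}" using second_max_less[OF assms(1,2)] by force
  show "second_max (insert u A) = (if u > Max A then Max A else max u (second_max A))"
  proof (cases "u > Max A")
    case True
    then show ?thesis unfolding second_max_def M using assms(3) by (simp add: max_def)
  next
    case False
    moreover have "Max A \<in> A" using ne assms(1) by simp
    ultimately have "max u (Max A) = Max A" "u \<noteq> Max A" using assms(3) by auto
    then have "insert u A - {Max (insert u A)} = insert u (A - {Max A})"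
      unfolding M by auto
    then show ?thesis
      unfolding second_max_def using False \<open>A - {Max A} \<noteq> {}\<close> assms(1) by simp
  qed
qed

definition ordered_graph :: "nat \<Rightarrow> nat \<Rightarrow> nat set \<Rightarrow> nat hypergraph" where
  "ordered_graph k N C = Hypergraph {..<N}
     {e. e \<subseteq> {..<N} \<and> card e = k \<and> (Max e \<in> C) \<noteq> (second_max e \<in> C)}"

lemma kgraph_ordered_graph: "kgraph k (ordered_graph k N C)"
  by (auto simp: kgraph_def ordered_graph_def)

text \<open>Decreases along predecessors: a two-coloured top pair is preceded by two-coloured ones with
  growing second element, a one-coloured top pair by two-coloured ones or by one-coloured ones with
  decreasing second element.\<close>

definition top_rank :: "nat \<Rightarrow> nat set \<Rightarrow> nat set \<Rightarrow> nat" where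
  "top_rank N C A = (if (Max A \<in> C) = (second_max A \<in> C) then N + 1 + second_max A
     else N - second_max A)"

text \<open>If \<open>u\<close> exceeds the second largest element of \<open>A\<close>, the top two
  elements of the edge are \<open>u\<close> and \<open>Max A\<close> in some order; otherwise they
  are the top two of \<open>A\<close>.\<close>

lemma ordered_graph_insert_edge:
  assumes "insert u A \<in> edges (ordered_graph k N C)" "finite A" "card A \<ge> 2" "u \<notin> A"
  shows "if u > second_max A then (u \<in> C) \<noteq> (Max A \<in> C) else (second_max A \<in> C) \<noteq> (Max A \<in> C)"
proof -
  have *: "(max u (Max A) \<in> C) \<noteq> ((if u > Max A then Max A else max u (second_max A)) \<in> C)"
    using assms(1) unfolding ordered_graph_def
    by (simp only: hypergraph.sel mem_Collect_eq Max_insert_eq[OF assms(2-4)]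
        second_max_insert[OF assms(2-4)] simp_thms)
  have "u \<noteq> Max A" "second_max A < Max A" using second_max_less[OF assms(2,3)] assms(4) by auto
  then show ?thesis using * by (auto simp: max_def split: if_splits)
qed

text \<open>Let s and t be the second largest elements of \<open>A\<close> and \<open>B\<close>;
  they differ since s is not in \<open>B\<close>. If t < s, both top elements of \<open>A\<close>
  are coloured opposite to \<open>Max B\<close>, so \<open>A\<close> has a one-coloured top pair. If
  s < t, the edge containing s shows that the top pair of \<open>B\<close> is two-coloured.\<close>

lemma top_rank_less:
  assumes "finite A" "card A \<ge> 2" "finite B" "card B \<ge> 2" "B \<subseteq> {..<N}" "Max A \<notin> B" "second_max A \<notin> B"
    and e: "insert (Max A) B \<in> edges (ordered_graph k N C)"
      "insert (second_max A) B \<in> edges (ordered_graph k N C)"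
  shows "top_rank N C B < top_rank N C A"
proof -
  have "second_max B \<in> B" "second_max A \<noteq> second_max B" "second_max A < Max A"
    using second_max_less[OF assms(3,4)] second_max_less[OF assms(1,2)] assms(7) by auto
  moreover have "second_max B < N" using calculation(1) assms(5) by auto
  ultimately show ?thesis
    using ordered_graph_insert_edge[OF e(1) assms(3,4,6)]
      ordered_graph_insert_edge[OF e(2) assms(3,4,7)]
    unfolding top_rank_def by (auto split: if_splits)
qed

text \<open>Only the child belonging to the positions of the two largest entries is followed; each
  such step lowers \<open>top_rank\<close>.\<close>

lemma lev_ordered_graph_le:
  assumes "k \<ge> 3" "lev k (ordered_graph k N C) n x" "card (x ` {..<k - 1}) = k - 1"
  shows "n \<le> top_rank N C (x ` {..<k - 1})"
  using assms(2,3)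
proof (induction n arbitrary: x)
  case (Suc n)
  let ?A = "x ` {..<k - 1}"
  have A: "finite ?A" "card ?A \<ge> 2" using Suc.prems(2) assms(1) by auto
  note sm = second_max_less[OF A]
  obtain p q where pq: "p < k - 1" "x p = Max ?A" "q < k - 1" "x q = second_max ?A"
    using sm by (metis (no_types, lifting) image_iff lessThan_iff)
  have "p \<noteq> q" using pq sm by auto
  obtain y where y: "insert (Max ?A) (y ` {..<k - 1}) \<in> edges (ordered_graph k N C)"
     "insert (second_max ?A) (y ` {..<k - 1}) \<in> edges (ordered_graph k N C)"
     "lev k (ordered_graph k N C) n y"
  proof (cases "p < q")
    case True
    with Suc.prems(1) pq that show ?thesis unfolding lev.simps by metis
  next
    case False
    with \<open>p \<noteq> q\<close> have "q < p" by simp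
    with Suc.prems(1) pq that show ?thesis unfolding lev.simps by metis
  qed
  let ?B = "y ` {..<k - 1}"
  \<comment> \<open>An edge has \<open>k\<close> elements and \<open>y\<close> contributes at most
    \<open>k - 1\<close>, so the entries of \<open>y\<close> are distinct and avoid
    \<open>v\<close>. This restores the induction hypothesis on distinct entries.\<close>
  have *: "card ?B = k - 1 \<and> v \<notin> ?B \<and> ?B \<subseteq> {..<N}"
    if "insert v ?B \<in> edges (ordered_graph k N C)" for v
  proof -
    have "card (insert v ?B) = k" "?B \<subseteq> {..<N}" using that by (auto simp: ordered_graph_def)
    moreover have "card ?B \<le> card {..<k - 1}" by (rule card_image_le) simp
    ultimately show ?thesis using assms(1) by (auto simp: card_insert_if split: if_splits)
  qed
  have "n \<le> top_rank N C ?B" using Suc.IH[OF y(3)] *[OF y(1)] by blast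
  also have "\<dots> < top_rank N C ?A"
    using *[OF y(1)] *[OF y(2)] assms(1) by (intro top_rank_less[where k = k] A y) auto
  finally show ?case by simp
qed simp

text \<open>The root tuple may have repeated entries, so one level is spent to reach a tuple with
  distinct ones. Its rank is at most 2N, one less than the \<open>2 * N + 1\<close> levels
  left.\<close>

lemma not_deep_ordered_graph:
  assumes "k \<ge> 3"
  shows "\<not> deep k (ordered_graph k N C) (2 * N + 2)"
proof
  assume "deep k (ordered_graph k N C) (2 * N + 2)"
  then obtain x where "lev k (ordered_graph k N C) (Suc (2 * N + 1)) x" by (auto simp: deep_def)
  moreover have "(0::nat) < 1 \<and> 1 < k - 1" using assms by simp
  ultimately obtain y where y: "insert (x 0) (y ` {..<k - 1}) \<in> edges (ordered_graph k N C)"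
    "lev k (ordered_graph k N C) (2 * N + 1) y"
    unfolding lev.simps by blast
  let ?B = "y ` {..<k - 1}"
  have B: "card (insert (x 0) ?B) = k" "?B \<subseteq> {..<N}" using y(1) by (auto simp: ordered_graph_def)
  moreover have "card ?B \<le> card {..<k - 1}" by (rule card_image_le) simp
  ultimately have c: "card ?B = k - 1" using assms by (auto simp: card_insert_if split: if_splits)
  then have "second_max ?B \<in> ?B" using assms by (intro second_max_less) auto
  with B(2) have "second_max ?B < N" by blast
  then have "N + 1 + second_max ?B < 2 * N + 1" "N - second_max ?B < 2 * N + 1" by linarith+
  then have "top_rank N C ?B < 2 * N + 1" by (simp only: top_rank_def split: if_split) blast
  with lev_ordered_graph_le[OF assms y(2) c] show False by simp
qed

text \<open>Recolouring \<open>Max e\<close> exchanges the colourings that make \<open>e\<close> an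
  edge with those that do not. So the average over all \<open>C\<close> is half of all
  \<open>k\<close>-sets, and some \<open>C\<close> reaches it.\<close>

lemma ordered_graph_dense:
  assumes "k \<ge> 2"
  shows "\<exists>C. N choose k \<le> 2 * card (edges (ordered_graph k N C))"
proof (rule ccontr)
  assume "\<not> ?thesis"
  then have less: "2 * card (edges (ordered_graph k N C)) < N choose k" for C
    by (simp add: not_le)
  let ?S = "{e. e \<subseteq> {..<N} \<and> card e = k}" and ?P = "Pow {..<N}"
  let ?R = "\<lambda>e C. (Max e \<in> C) \<noteq> (second_max e \<in> C)"
  have S: "finite ?S" by (rule finite_subset[of _ "Pow {..<N}"]) auto
  have half: "2 * card {C \<in> ?P. ?R e C} = 2 ^ N" if "e \<in> ?S" for e
  proof -
    have e: "finite e" "card e \<ge> 2" "e \<subseteq> {..<N}" using that assms finite_subset by auto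
    let ?m = "Max e" and ?s = "second_max e"
    have ms: "?m < N" "?s \<noteq> ?m" using second_max_less[OF e(1,2)] e(3) by auto
    let ?f = "\<lambda>C. sym_diff C {?m}"
    have "bij_betw ?f {C \<in> ?P. ?R e C} {C \<in> ?P. \<not> ?R e C}"
      by (rule bij_betw_byWitness[of _ ?f]) (use ms in auto)
    then have "card {C \<in> ?P. ?R e C} = card {C \<in> ?P. \<not> ?R e C}" by (rule bij_betw_same_card)
    moreover have "card {C \<in> ?P. ?R e C} + card {C \<in> ?P. \<not> ?R e C} = card ?P"
      by (subst card_Un_disjoint[symmetric]) (auto intro: arg_cong[of _ _ card])
    ultimately show ?thesis by (simp add: card_Pow)
  qed
  have "2 * (\<Sum>C\<in>?P. card (edges (ordered_graph k N C))) = 2 * (\<Sum>C\<in>?P. card {e \<in> ?S. ?R e C})"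
    by (simp add: ordered_graph_def conj_assoc)
  also have "\<dots> = 2 * (\<Sum>e\<in>?S. card {C \<in> ?P. ?R e C})"
    using S by (intro arg_cong[of _ _ "(*) 2"] sum_multicount_gen) auto
  also have "\<dots> = (\<Sum>e\<in>?S. 2 ^ N)"
    unfolding sum_distrib_left by (intro sum.cong refl half)
  also have "\<dots> = (\<Sum>C\<in>?P. N choose k)"
    by (simp add: n_subsets card_Pow)
  finally have "(\<Sum>C\<in>?P. 2 * card (edges (ordered_graph k N C))) = (\<Sum>C\<in>?P. N choose k)"
    by (simp add: sum_distrib_left)
  moreover have "(\<Sum>C\<in>?P. 2 * card (edges (ordered_graph k N C))) < (\<Sum>C\<in>?P. N choose k)"
    by (intro sum_strict_mono less) auto
  ultimately show False by simp
qed

text \<open>Hypergraphs of this depth have no homomorphism into an ordered graph on \<open>N\<close>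
  vertices, so the blow-up bound applies to a colouring for which at least half of the
  \<open>k\<close>-sets are edges.\<close>

lemma ex_ratio_ge_if_deep:
  assumes "k \<ge> 3" "k \<le> m" "N \<ge> 1" "\<And>F. F \<in> \<F> \<Longrightarrow> deep k F (2 * N + 2)"
  shows "(1 / 2) * (real (N choose k) * fact k / real N ^ k) \<le> ex_ratio k \<F> m"
proof -
  obtain C where C: "N choose k \<le> 2 * card (edges (ordered_graph k N C))"
    using ordered_graph_dense[of k N] assms(1) by auto
  have half: "1 / 2 * a \<le> b" if "a \<le> 2 * b" for a b :: real using that by simp
  have "real (N choose k) \<le> 2 * real (card (edges (ordered_graph k N C)))"
    using C by linarith
  then have "real (N choose k) * fact k \<le> 2 * real (card (edges (ordered_graph k N C))) * fact k"
    by (intro mult_right_mono) auto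
  then have "real (N choose k) * fact k / real N ^ k \<le>
      2 * real (card (edges (ordered_graph k N C))) * fact k / real N ^ k"
    by (intro divide_right_mono) auto
  also have "\<dots> = 2 * (real (card (edges (ordered_graph k N C))) * fact k / real N ^ k)"
    by simp
  finally have "(1 / 2) * (real (N choose k) * fact k / real N ^ k) \<le>
      real (card (edges (ordered_graph k N C))) * fact k / real N ^ k"
    using half by blast
  also have "\<dots> \<le> ex_ratio k \<F> m"
  proof -
    have "\<not> is_hom f F (ordered_graph k N C)" if "F \<in> \<F>" for F f
      using assms(4)[OF that] not_deep_ordered_graph[OF assms(1)] deep_hom by blast
    from ex_ratio_ge_if_no_hom[where \<F> = \<F>, OF kgraph_ordered_graph _ this assms(2)] show ?thesis
      using assms(3) by (auto simp: ordered_graph_def lessThan_empty_iff)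
  qed
  finally show ?thesis .
qed

section \<open>Links and stability below density one half\<close>

text \<open>Links consist of ordered tuples, so that all of them lie in one set of size
  \<open>card U ^ (k - 1)\<close> and can be compared by cardinality.\<close>

definition link :: "nat \<Rightarrow> 'a hypergraph \<Rightarrow> 'a set \<Rightarrow> 'a \<Rightarrow> (nat \<Rightarrow> 'a) set" where
  "link k H U v = {y \<in> {..<k - 1} \<rightarrow>\<^sub>E U. insert v (y ` {..<k - 1}) \<in> edges H}"

lemma card_link:
  assumes "kgraph k H" "k \<ge> 1" "finite U" "v \<in> U"
  shows "card (link k H U v) = card {e \<in> edges H. e \<subseteq> U \<and> v \<in> e} * fact (k - 1)"
proof -
  let ?D = "{e \<in> edges H. e \<subseteq> U \<and> v \<in> e}"
  let ?A = "(\<lambda>e. e - {v}) ` ?D"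
  have k: "card e = k" if "e \<in> edges H" for e using kgraph_edgeD[OF assms(1) that] by simp
  have *: "insert v Y \<in> edges H \<longleftrightarrow> Y \<in> ?A" if Y: "Y = y ` {..<k - 1}" "Y \<subseteq> U" for y Y
  proof
    assume e: "insert v Y \<in> edges H"
    have "finite Y" "card Y \<le> k - 1" using Y(1) card_image_le[of "{..<k - 1}" y] by auto
    then have "v \<notin> Y" using k[OF e] assms(2) by (auto simp: card_insert_if split: if_splits)
    then have "Y = insert v Y - {v}" by simp
    then show "Y \<in> ?A" using e Y(2) assms(4) by blast
  next
    assume "Y \<in> ?A"
    then show "insert v Y \<in> edges H" by (auto simp: insert_absorb)
  qed
  have "insert v (y ` {..<k - 1}) \<in> edges H \<longleftrightarrow> y ` {..<k - 1} \<in> ?A" if "y \<in> {..<k - 1} \<rightarrow>\<^sub>E U" for y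
    using that by (intro *[OF refl]) auto
  then have "link k H U v = {y \<in> {..<k - 1} \<rightarrow>\<^sub>E U. y ` {..<k - 1} \<in> ?A}"
    unfolding link_def by blast
  also have "card \<dots> = card ?A * fact (card {..<k - 1})"
  proof (rule card_image_in_PiE)
    fix a assume "a \<in> ?A"
    then obtain e where e: "a = e - {v}" "e \<in> edges H" "e \<subseteq> U" "v \<in> e" by blast
    then show "a \<subseteq> U \<and> card a = card {..<k - 1}" using k[OF e(2)] by auto
  qed (use assms(3) in auto)
  also have "card ?A = card ?D"
    by (intro card_image inj_onI) blast
  finally show ?thesis by simp
qed

section \<open>A vertex subset with uniformly large links\<close>

lemma power_Suc_increment:
  fixes x :: real
  assumes "x \<ge> 0"
  shows "x ^ Suc n + real (Suc n) * x ^ n \<le> (x + 1) ^ Suc n"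
proof (induction n)
  case (Suc n)
  have "x ^ Suc (Suc n) + real (Suc (Suc n)) * x ^ Suc n \<le>
      (x + 1) * (x ^ Suc n + real (Suc n) * x ^ n)"
    using assms by (simp add: algebra_simps)
  also have "\<dots> \<le> (x + 1) * (x + 1) ^ Suc n"
    using Suc assms by (intro mult_left_mono) auto
  finally show ?case by simp
qed simp

text \<open>Otherwise every nonempty vertex set has a vertex with a small link, and deleting such
  vertices one by one leaves too few edges in total. \<open>power_Suc_increment\<close> shows that
  the potential \<open>c * (card U + 1) ^ k\<close> pays for each deletion.\<close>

lemma dense_core:
  fixes c :: real
  assumes "kgraph k H" "k \<ge> 1" "c \<ge> 0"
    and dense: "c * (real (card (verts H)) + 1) ^ k < fact k * real (card (edges H))"
  obtains U where "U \<subseteq> verts H" "U \<noteq> {}"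
    "\<And>v. v \<in> U \<Longrightarrow> c * real (card U) ^ (k - 1) < real (card (link k H U v))"
proof (rule ccontr)
  assume no: "\<not> thesis"
  note witness = that
  have fin: "finite (verts H)" "finite (edges H)"
    using assms(1) finite_edges by (auto simp: kgraph_def)
  have "fact k * real (card {e \<in> edges H. e \<subseteq> U}) \<le> c * (real (card U) + 1) ^ k"
    if "U \<subseteq> verts H" for U
    using finite_subset[OF that fin(1)] that
  proof (induction U rule: finite_remove_induct)
    case empty
    have "{e \<in> edges H. e \<subseteq> {}} = {}"
      using kgraph_edgeD[OF assms(1)] assms(2) by fastforce
    then have "card {e \<in> edges H. e \<subseteq> {}} = 0" by (simp only: card.empty)
    then show ?case using assms(3) by (simp only: mult_zero_right of_nat_0) simp
  next
    case (remove U)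
    have "\<not> (\<forall>v\<in>U. c * real (card U) ^ (k - 1) < real (card (link k H U v)))"
      using no witness[of U] remove(2,5) by blast
    then obtain v where v: "v \<in> U" "real (card (link k H U v)) \<le> c * real (card U) ^ (k - 1)"
      using not_less by blast
    let ?u = "real (card U)"
    have "finite U" using remove by simp
    have k: "k = Suc (k - 1)" using assms(2) by simp
    have "{e \<in> edges H. e \<subseteq> U} = {e \<in> edges H. e \<subseteq> U - {v}} \<union> {e \<in> edges H. e \<subseteq> U \<and> v \<in> e}"
      by auto
    then have "card {e \<in> edges H. e \<subseteq> U} \<le>
        card {e \<in> edges H. e \<subseteq> U - {v}} + card {e \<in> edges H. e \<subseteq> U \<and> v \<in> e}"
      by (simp only: card_Un_le)
    then have "fact k * real (card {e \<in> edges H. e \<subseteq> U}) \<le> fact k *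
        (real (card {e \<in> edges H. e \<subseteq> U - {v}}) + real (card {e \<in> edges H. e \<subseteq> U \<and> v \<in> e}))"
      by (intro mult_left_mono) auto
    also have "\<dots> = fact k * real (card {e \<in> edges H. e \<subseteq> U - {v}}) +
        real k * real (card (link k H U v))"
      using card_link[OF assms(1,2) \<open>finite U\<close> v(1)] k fact_Suc[of "k - 1", where 'a = real]
      by (simp add: algebra_simps)
    also have "\<dots> \<le> c * (real (card (U - {v})) + 1) ^ k + real k * (c * ?u ^ (k - 1))"
      using remove v(1) by (intro add_mono mult_left_mono v(2) remove.IH) auto
    also have "real (card (U - {v})) + 1 = ?u"
      using card_Suc_Diff1[OF \<open>finite U\<close> v(1)] by linarith
    also have "c * ?u ^ k + real k * (c * ?u ^ (k - 1)) = c * (?u ^ k + real k * ?u ^ (k - 1))"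
      by (simp add: algebra_simps)
    also have "\<dots> \<le> c * (?u + 1) ^ k"
      using power_Suc_increment[of ?u "k - 1"] assms(3) k by (intro mult_left_mono) auto
    finally show ?case .
  qed
  from this[OF subset_refl] have "fact k * real (card {e \<in> edges H. e \<subseteq> verts H}) \<le>
      c * (real (card (verts H)) + 1) ^ k" .
  moreover have "{e \<in> edges H. e \<subseteq> verts H} = edges H" using assms(1) by (auto simp: kgraph_def)
  ultimately show False using dense by simp
qed

lemma card_tuples: "card ({..<n} \<rightarrow>\<^sub>E U) = card U ^ n"
  by (simp add: card_funcsetE)

text \<open>Two links that each hold more than half of all tuples intersect, so \<open>U\<close>
  feeds itself.\<close>

lemma deep_if_links_gt_half:
  assumes "finite U" "U \<noteq> {}"
    "\<And>v. v \<in> U \<Longrightarrow> 1 / 2 * real (card U) ^ (k - 1) < real (card (link k H U v))"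
  shows "deep k H n"
proof (rule deep_if_mutual[OF assms(2) refl])
  fix v w assume vw: "v \<in> U" "w \<in> U"
  let ?X = "{..<k - 1} \<rightarrow>\<^sub>E U"
  have X: "finite ?X" by (intro finite_PiE) (use assms(1) in auto)
  have "link k H U v \<inter> link k H U w \<noteq> {}"
  proof
    assume "link k H U v \<inter> link k H U w = {}"
    then have "card (link k H U v) + card (link k H U w) = card (link k H U v \<union> link k H U w)"
      by (intro card_Un_disjoint[symmetric] finite_subset[OF _ X]) (auto simp: link_def)
    also have "\<dots> \<le> card ?X"
      by (intro card_mono X) (auto simp: link_def)
    finally have "real (card (link k H U v)) + real (card (link k H U w)) \<le> real (card U) ^ (k - 1)"
      unfolding card_tuples by (metis of_nat_add of_nat_le_iff of_nat_power)
    then show False using assms(3)[OF vw(1)] assms(3)[OF vw(2)] by simp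
  qed
  then obtain y where "y \<in> link k H U v" "y \<in> link k H U w" by blast
  then show "\<exists>y \<in> {..<k - 1} \<rightarrow> U.
      insert v (y ` {..<k - 1}) \<in> edges H \<and> insert w (y ` {..<k - 1}) \<in> edges H"
    unfolding link_def by (intro bexI[of _ y]) auto
  then show "\<exists>y \<in> {..<k - 1} \<rightarrow> U.
      insert v (y ` {..<k - 1}) \<in> edges H \<and> insert w (y ` {..<k - 1}) \<in> edges H" .
qed

lemma deep_if_dense:
  assumes "kgraph k H" "k \<ge> 1"
    "1 / 2 * (real (card (verts H)) + 1) ^ k < fact k * real (card (edges H))"
  shows "deep k H n"
proof -
  obtain U where "U \<subseteq> verts H" "U \<noteq> {}"
    "\<And>v. v \<in> U \<Longrightarrow> 1 / 2 * real (card U) ^ (k - 1) < real (card (link k H U v))"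
    by (rule dense_core[OF assms(1,2) _ assms(3)]) auto
  moreover from this have "finite U" using assms(1) finite_subset by (auto simp: kgraph_def)
  ultimately show ?thesis by (intro deep_if_links_gt_half[of U]) auto
qed

text \<open>A vertex \<open>a\<close> and its partner \<open>b\<close> whose links are almost complementary: all vertices paired
  with \<open>b\<close> have almost the link of \<open>a\<close>, all vertices paired with \<open>a\<close> almost the complementary one.
  Whichever way the link of \<open>a\<close> meets the two groups \<open>A\<close> and \<open>B\<close> formed by these vertices, one of
  them feeds itself or both feed each other.\<close>

lemma deep_if_many_disjoint_links:
  fixes H :: "'a hypergraph" and \<gamma> \<eta> \<rho> \<tau> :: real
  assumes U: "finite U" "U \<noteq> {}"
    and links: "\<And>v. v \<in> U \<Longrightarrow> (1 / 2 - \<eta>) * real (card U) ^ (k - 1) \<le> card (link k H U v)"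
    and T: "T \<subseteq> U \<times> U" "sym T"
      "\<And>u v. (u, v) \<in> T \<Longrightarrow> card (link k H U u \<inter> link k H U v) \<le> \<gamma> * real (card U) ^ (k - 1)"
      "2 * \<tau> * real (card U) ^ 2 < card T"
    and par: "0 < \<tau>" "0 < \<rho>" "\<gamma> \<le> \<rho>" "2 * \<eta> + \<gamma> \<le> \<rho>" "6 * \<rho> < \<tau> ^ (k - 1)"
  shows "deep k H n"
proof -
  define K where "K = k - 1"
  define m where "m = real (card U)"
  define X where "X = {..<K} \<rightarrow>\<^sub>E U"
  define L where "L = link k H U"
  define N where "N = (\<lambda>v. {u. (u, v) \<in> T})"
  have m: "m > 0" using U by (simp add: m_def card_gt_0_iff)
  have X: "finite X" "real (card X) = m ^ K"
    using U(1) by (auto simp: X_def m_def card_tuples intro!: finite_PiE)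
  have LX: "L v \<subseteq> X" for v by (auto simp: L_def link_def X_def K_def)
  have NU: "N v \<subseteq> U" for v using T(1) by (auto simp: N_def)
  have finN: "finite (N v)" for v using NU U(1) finite_subset by blast
  have finX: "finite Z" if "Z \<subseteq> X" for Z using that X(1) finite_subset by blast
  \<comment> \<open>Otherwise every pair in \<open>T\<close> has an endpoint with fewer than
    \<open>\<tau> * m\<close> partners, so \<open>T\<close> has at most
    \<open>2 * m * (\<tau> * m)\<close> elements.\<close>
  have "\<exists>a b. (a, b) \<in> T \<and> \<tau> * m \<le> card (N a) \<and> \<tau> * m \<le> card (N b)"
  proof (rule ccontr)
    assume no: "\<not> ?thesis"
    let ?W = "{u \<in> U. card (N u) < \<tau> * m}"
    let ?S = "SIGMA u:?W. N u"
    have "T \<subseteq> ?S \<union> prod.swap ` ?S"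
    proof
      fix p assume "p \<in> T"
      obtain a b where p: "p = (a, b)" by (cases p)
      with \<open>p \<in> T\<close> have T': "(a, b) \<in> T" "(b, a) \<in> T" using symD[OF T(2)] by simp_all
      with no have "\<not> (\<tau> * m \<le> card (N a) \<and> \<tau> * m \<le> card (N b))" by blast
      then have "card (N a) < \<tau> * m \<or> card (N b) < \<tau> * m" by linarith
      moreover have "a \<in> U" "b \<in> U" using T' T(1) by auto
      ultimately have "(a, b) \<in> ?S \<or> (b, a) \<in> ?S" using T' by (auto simp: N_def)
      then show "p \<in> ?S \<union> prod.swap ` ?S"
      proof
        assume "(b, a) \<in> ?S"
        then have "prod.swap (b, a) \<in> prod.swap ` ?S" by (rule imageI)
        then show ?thesis using p by simp
      qed (simp add: p)
    qed
    moreover have S: "finite ?S" using U(1) finN by auto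
    ultimately have "card T \<le> card (?S \<union> prod.swap ` ?S)" by (intro card_mono) auto
    also have "\<dots> \<le> card ?S + card (prod.swap ` ?S)" by (rule card_Un_le)
    also have "\<dots> \<le> card ?S + card ?S" by (intro add_left_mono card_image_le S)
    finally have "real (card T) \<le> 2 * real (card ?S)" by simp
    also have "real (card ?S) = (\<Sum>u\<in>?W. real (card (N u)))"
      using U(1) finN by simp
    also have "\<dots> \<le> (\<Sum>u\<in>?W. \<tau> * m)" by (intro sum_mono) auto
    also have "\<dots> \<le> m * (\<tau> * m)"
      using U(1) m par(1) by (auto simp: m_def intro!: mult_right_mono card_mono)
    finally show False using T(4) by (simp add: m_def power2_eq_square mult_ac)
  qed
  then obtain a b where ab: "(a, b) \<in> T" "\<tau> * m \<le> card (N a)" "\<tau> * m \<le> card (N b)" by blast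
  define A B P where "A = N b" and "B = N a" and "P = L a"
  \<comment> \<open>The two links have total size at least \<open>(1 - 2 * \<eta>) * m ^ K\<close>
    and overlap in at most \<open>\<gamma> * m ^ K\<close> tuples; by inclusion-exclusion their
    union misses at most \<open>(2 * \<eta> + \<gamma>) * m ^ K\<close>.\<close>
  have cover: "card (X - (L u \<union> L v)) \<le> \<rho> * m ^ K" and inter: "card (L u \<inter> L v) \<le> \<rho> * m ^ K"
    if uv: "(u, v) \<in> T" for u v
  proof -
    have "u \<in> U" "v \<in> U" using uv T(1) by auto
    then have d: "(1 / 2 - \<eta>) * m ^ K \<le> card (L u)" "(1 / 2 - \<eta>) * m ^ K \<le> card (L v)"
      using links by (auto simp: L_def m_def K_def)
    have i: "card (L u \<inter> L v) \<le> \<gamma> * m ^ K" using T(3)[OF uv] by (simp add: L_def m_def K_def)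
    moreover have "\<gamma> * m ^ K \<le> \<rho> * m ^ K" using par(3) m by (intro mult_right_mono) auto
    ultimately show "card (L u \<inter> L v) \<le> \<rho> * m ^ K" by linarith
    have "card (L u) + card (L v) = card (L u \<union> L v) + card (L u \<inter> L v)"
      using LX finX by (intro card_Un_Int) auto
    moreover have "card (X - (L u \<union> L v)) + card (L u \<union> L v) = card X"
    proof -
      have sub: "L u \<union> L v \<subseteq> X" using LX by blast
      show ?thesis
        using card_Diff_subset[OF finX[OF sub] sub] card_mono[OF X(1) sub] by linarith
    qed
    ultimately have "real (card (X - (L u \<union> L v))) =
        m ^ K - card (L u) - card (L v) + card (L u \<inter> L v)"
      unfolding X(2)[symmetric] by linarith
    also have "\<dots> \<le> m ^ K - (1 / 2 - \<eta>) * m ^ K - (1 / 2 - \<eta>) * m ^ K + \<gamma> * m ^ K"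
      using d i by linarith
    also have "\<dots> = (2 * \<eta> + \<gamma>) * m ^ K" by (simp add: algebra_simps)
    also have "\<dots> \<le> \<rho> * m ^ K" using par(4) m by (intro mult_right_mono) auto
    finally show "card (X - (L u \<union> L v)) \<le> \<rho> * m ^ K" .
  qed
  \<comment> \<open>A tuple of \<open>P\<close> outside the link of \<open>u\<close> lies in the
    links of both \<open>a\<close> and \<open>b\<close>, or in neither that of \<open>u\<close> nor
    that of \<open>b\<close>: two errors of relative size \<open>\<rho>\<close>.\<close>
  have A: "card (P - L u) \<le> 2 * \<rho> * m ^ K" if "u \<in> A" for u
  proof -
    have "(u, b) \<in> T" using that by (simp add: A_def N_def)
    have "card (P - L u) \<le> card ((L a \<inter> L b) \<union> (X - (L u \<union> L b)))"
      using LX[of a] by (intro card_mono finX) (auto simp: P_def)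
    also have "\<dots> \<le> card (L a \<inter> L b) + card (X - (L u \<union> L b))" by (rule card_Un_le)
    finally have "real (card (P - L u)) \<le> card (L a \<inter> L b) + card (X - (L u \<union> L b))" by simp
    with inter[OF ab(1)] cover[OF \<open>(u, b) \<in> T\<close>] show ?thesis by simp
  qed
  have B: "card (X - P - L u) \<le> \<rho> * m ^ K" if "u \<in> B" for u
  proof -
    have "(u, a) \<in> T" using that by (simp add: B_def N_def)
    moreover have "X - P - L u = X - (L u \<union> L a)" by (auto simp: P_def)
    ultimately show ?thesis using cover by simp
  qed
  \<comment> \<open>Each link misses at most \<open>c\<close> tuples of \<open>Q\<close>, so more
    than \<open>2 * c\<close> of them include a common one.\<close>
  have common: "\<exists>y\<in>Z. y \<in> L u \<and> y \<in> L v"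
    if "Z \<subseteq> Q" "Q \<subseteq> X" "c + c < card Z" "card (Q - L u) \<le> c" "card (Q - L v) \<le> c"
    for Z Q u v and c :: real
  proof (rule ccontr)
    assume "\<not> ?thesis"
    then have "Z \<subseteq> (Q - L u) \<union> (Q - L v)" using that(1) by blast
    then have "card Z \<le> card ((Q - L u) \<union> (Q - L v))"
      using that(2) by (intro card_mono finX) auto
    also have "\<dots> \<le> card (Q - L u) + card (Q - L v)" by (rule card_Un_le)
    finally show False using that(3-5) by linarith
  qed
  have commonA: "\<exists>y\<in>Z. y \<in> L u \<and> y \<in> L v"
    if "Z \<subseteq> P" "4 * \<rho> * m ^ K < card Z" "u \<in> A" "v \<in> A" for Z u v
    using common[OF that(1) _ _ A[OF that(3)] A[OF that(4)]] that(2) LX by (simp add: P_def)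
  have commonB: "\<exists>y\<in>Z. y \<in> L u \<and> y \<in> L v"
    if "Z \<subseteq> X - P" "2 * \<rho> * m ^ K < card Z" "u \<in> B" "v \<in> B" for Z u v
    using common[OF that(1) _ _ B[OF that(3)] B[OF that(4)]] that(2) by simp
  have AB: "A \<subseteq> U" "B \<subseteq> U" "\<tau> * m \<le> card A" "\<tau> * m \<le> card B"
    using NU ab by (auto simp: A_def B_def)
  have pos: "0 < \<tau> * m" using par(1) m by simp
  have ne: "A \<noteq> {}" "B \<noteq> {}" using AB(3,4) pos by auto
  \<comment> \<open>The 6 is 4 + 2: tuples over a large \<open>Y\<close> either give the 4 inside
    \<open>P\<close> required by \<open>commonA\<close>, or the 2 outside \<open>P\<close> required
    by \<open>commonB\<close>.\<close>
  have split: "6 * \<rho> * m ^ K < real (card (P \<inter> ({..<K} \<rightarrow>\<^sub>E Y))) + card (({..<K} \<rightarrow>\<^sub>E Y) - P)"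
    if "Y \<subseteq> U" "\<tau> * m \<le> card Y" for Y
  proof -
    have "6 * \<rho> * m ^ K < \<tau> ^ K * m ^ K"
      using par(5) m by (intro mult_strict_right_mono) (auto simp: K_def)
    also have "\<dots> = (\<tau> * m) ^ K" by (simp add: power_mult_distrib)
    also have "\<dots> \<le> real (card Y) ^ K" using that(2) pos by (intro power_mono) auto
    also have "\<dots> = card ({..<K} \<rightarrow>\<^sub>E Y)" by (simp add: card_tuples)
    also have "card ({..<K} \<rightarrow>\<^sub>E Y) = card (P \<inter> ({..<K} \<rightarrow>\<^sub>E Y)) + card (({..<K} \<rightarrow>\<^sub>E Y) - P)"
    proof -
      have "finite ({..<K} \<rightarrow>\<^sub>E Y)"
        using that(1) U(1) finite_subset by (intro finite_PiE) auto
      then show ?thesis using card_Int_Diff[of "{..<K} \<rightarrow>\<^sub>E Y" P] by (simp add: Int_commute)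
    qed
    finally show ?thesis by simp
  qed
  have tupX: "{..<K} \<rightarrow>\<^sub>E Y \<subseteq> X" if "Y \<subseteq> U" for Y
    using that unfolding X_def by (intro PiE_mono)
  have mutual: "\<exists>y \<in> {..<K} \<rightarrow> Y. insert u (y ` {..<K}) \<in> edges H \<and> insert v (y ` {..<K}) \<in> edges H"
    if ex: "\<exists>y\<in>Z. y \<in> L u \<and> y \<in> L v" and sub: "Z \<subseteq> {..<K} \<rightarrow>\<^sub>E Y" for Z Y u v
  proof -
    obtain y where "y \<in> Z" "y \<in> L u" "y \<in> L v" using ex by blast
    then show ?thesis
      using subsetD[OF sub] unfolding L_def link_def K_def[symmetric]
      by (intro bexI[of _ y]) auto
  qed
  \<comment> \<open>Tuples inside \<open>P\<close> serve as predecessors for \<open>A\<close>,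
    tuples outside \<open>P\<close> for \<open>B\<close>. Either \<open>A\<close> feeds itself or
    \<open>A\<close> feeds \<open>B\<close>; in the latter case \<open>B\<close> feeds itself or
    feeds \<open>A\<close>.\<close>
  show ?thesis
  proof (cases "4 * \<rho> * m ^ K < card (P \<inter> ({..<K} \<rightarrow>\<^sub>E A))")
    case True
    have *: "\<exists>y \<in> {..<K} \<rightarrow> A. insert u (y ` {..<K}) \<in> edges H \<and> insert v (y ` {..<K}) \<in> edges H"
      if "u \<in> A" "v \<in> A" for u v
      by (rule mutual[OF commonA[OF Int_lower1 True that] Int_lower2])
    show ?thesis by (rule deep_if_mutual[OF ne(1) K_def * *])
  next
    case False
    then have "2 * \<rho> * m ^ K < card (({..<K} \<rightarrow>\<^sub>E A) - P)" using split[OF AB(1,3)] by simp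
    note large = this
    have BA: "\<exists>y \<in> {..<K} \<rightarrow> A. insert u (y ` {..<K}) \<in> edges H \<and> insert v (y ` {..<K}) \<in> edges H"
      if "u \<in> B" "v \<in> B" for u v
      by (rule mutual[OF commonB[OF _ large that]]) (use tupX[OF AB(1)] in auto)
    show ?thesis
    proof (cases "2 * \<rho> * m ^ K < card (({..<K} \<rightarrow>\<^sub>E B) - P)")
      case True
      have *: "\<exists>y \<in> {..<K} \<rightarrow> B. insert u (y ` {..<K}) \<in> edges H \<and> insert v (y ` {..<K}) \<in> edges H"
        if "u \<in> B" "v \<in> B" for u v
        by (rule mutual[OF commonB[OF _ True that]]) (use tupX[OF AB(2)] in auto)
      show ?thesis by (rule deep_if_mutual[OF ne(2) K_def * *])
    next
      case False
      then have large: "4 * \<rho> * m ^ K < card (P \<inter> ({..<K} \<rightarrow>\<^sub>E B))" using split[OF AB(2,4)] by simp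
      have *: "\<exists>y \<in> {..<K} \<rightarrow> B. insert u (y ` {..<K}) \<in> edges H \<and> insert v (y ` {..<K}) \<in> edges H"
        if "u \<in> A" "v \<in> A" for u v
        by (rule mutual[OF commonA[OF Int_lower1 large that] Int_lower2])
      show ?thesis by (rule deep_if_mutual[OF ne(1) K_def * BA])
    qed
  qed
qed

section \<open>Nearly half dense and shallow: almost all tuples have high level\<close>

lemma card_tuples_pair_in:
  assumes "finite U" "T \<subseteq> U \<times> U" "i < j" "j < K"
  shows "card {x \<in> {..<K} \<rightarrow>\<^sub>E U. (x i, x j) \<in> T} \<le> card T * card U ^ (K - 2)"
proof -
  let ?J = "{i, j}"
  have J: "?J \<subseteq> {..<K}" "card ?J = 2" using assms(3,4) by auto
  have T: "finite T" using assms(1,2) finite_subset by blast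
  have "card {x \<in> {..<K} \<rightarrow>\<^sub>E U. (x i, x j) \<in> T} =
      card {x \<in> {..<K} \<rightarrow>\<^sub>E U. (restrict x ?J i, restrict x ?J j) \<in> T}"
    by simp
  also have "\<dots> = card {y \<in> ?J \<rightarrow>\<^sub>E U. (y i, y j) \<in> T} * card U ^ card ({..<K} - ?J)"
    by (rule card_PiE_restrict[OF _ J(1), where P = "\<lambda>y. (y i, y j) \<in> T"]) simp
  also have "card ({..<K} - ?J) = K - 2"
    using card_Diff_subset[of ?J "{..<K}"] J by simp
  also have "card {y \<in> ?J \<rightarrow>\<^sub>E U. (y i, y j) \<in> T} \<le> card T"
  proof (rule card_inj_on_le[of "\<lambda>y. (y i, y j)"])
    show "inj_on (\<lambda>y. (y i, y j)) {y \<in> ?J \<rightarrow>\<^sub>E U. (y i, y j) \<in> T}"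
      by (rule inj_onI) (auto intro: PiE_ext)
  qed (use T in auto)
  finally show ?thesis by simp
qed

text \<open>Induction on \<open>l\<close>. A tuple failing level \<open>Suc l\<close> has two
  entries whose common predecessors all fail level \<open>l\<close>; these are few, so the two links
  are almost disjoint. Many failing tuples thus give many almost disjoint pairs of links, which
  force every depth and contradict shallowness. \<open>\<eta>\<close> is uniform in
  \<open>H\<close>, \<open>U\<close> and \<open>n\<close>.\<close>

lemma few_tuples_not_lev:
  fixes \<gamma> :: real
  assumes "k \<ge> 3" "\<gamma> > 0"
  shows "\<exists>\<eta>>0. \<forall>(H :: 'a hypergraph) U n. finite U \<longrightarrow> U \<noteq> {} \<longrightarrow>
    (\<forall>v\<in>U. (1 / 2 - \<eta>) * real (card U) ^ (k - 1) \<le> card (link k H U v)) \<longrightarrow> \<not> deep k H n \<longrightarrow>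
    real (card {x \<in> {..<k - 1} \<rightarrow>\<^sub>E U. \<not> lev k H l x}) \<le> \<gamma> * real (card U) ^ (k - 1)"
  using assms(2)
proof (induction l arbitrary: \<gamma>)
  case 0
  then show ?case by (intro exI[of _ 1]) simp
next
  case (Suc l)
  define K where "K = k - 1"
  \<comment> \<open>At most \<open>K ^ 2\<close> pairs of positions are involved, so more than
    \<open>\<gamma> * m ^ K\<close> failing tuples, with m the size of \<open>U\<close>, give more
    than \<open>2 * \<tau> * m ^ 2\<close> pairs of vertices. The 7 secures
    \<open>6 * \<rho> < \<tau> ^ K\<close>, and bounding both errors by \<open>\<rho> / 3\<close>
    secures \<open>2 * \<eta> + \<rho> / 3 \<le> \<rho>\<close>.\<close>
  define \<tau> where "\<tau> = \<gamma> / (2 * real K ^ 2)"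
  define \<rho> where "\<rho> = \<tau> ^ K / 7"
  have K: "K \<ge> 2" using assms(1) by (simp add: K_def)
  have pos: "\<tau> > 0" "\<rho> > 0" using K Suc.prems by (auto simp: \<tau>_def \<rho>_def)
  then have "\<rho> / 3 > 0" by simp
  from Suc.IH[OF this] obtain \<eta>\<^sub>0 where \<eta>0: "\<eta>\<^sub>0 > 0" and
    IH: "\<And>(H :: 'a hypergraph) U n. finite U \<Longrightarrow> U \<noteq> {} \<Longrightarrow>
      (\<forall>v\<in>U. (1 / 2 - \<eta>\<^sub>0) * real (card U) ^ K \<le> card (link k H U v)) \<Longrightarrow> \<not> deep k H n \<Longrightarrow>
      real (card {x \<in> {..<K} \<rightarrow>\<^sub>E U. \<not> lev k H l x}) \<le> \<rho> / 3 * real (card U) ^ K"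
    unfolding K_def by blast
  define \<eta> where "\<eta> = min \<eta>\<^sub>0 (\<rho> / 3)"
  have "\<eta> > 0" using \<eta>0 pos by (simp add: \<eta>_def)
  moreover have "real (card {x \<in> {..<K} \<rightarrow>\<^sub>E U. \<not> lev k H (Suc l) x}) \<le> \<gamma> * real (card U) ^ K"
    if U: "finite U" "U \<noteq> {}"
      and links: "\<forall>v\<in>U. (1 / 2 - \<eta>) * real (card U) ^ K \<le> card (link k H U v)"
      and shallow: "\<not> deep k H n"
    for H :: "'a hypergraph" and U n
  proof (rule ccontr)
    assume many: "\<not> ?thesis"
    let ?m = "real (card U)" and ?L = "link k H U" and ?X = "{..<K} \<rightarrow>\<^sub>E U"
    have m: "?m > 0" using U by (simp add: card_gt_0_iff)
    have X: "finite ?X" using U(1) by (intro finite_PiE) auto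
    have "(1 / 2 - \<eta>\<^sub>0) * ?m ^ K \<le> (1 / 2 - \<eta>) * ?m ^ K"
      using m by (intro mult_right_mono) (auto simp: \<eta>_def)
    with links have "\<forall>v\<in>U. (1 / 2 - \<eta>\<^sub>0) * ?m ^ K \<le> card (?L v)" by force
    note few = IH[OF U this shallow]
    define T where "T = {(u, v) \<in> U \<times> U. card (?L u \<inter> ?L v) \<le> \<rho> / 3 * ?m ^ K}"
    have TU: "T \<subseteq> U \<times> U" and "sym T" by (auto simp: T_def sym_def Int_commute)
    have "{x \<in> ?X. \<not> lev k H (Suc l) x} \<subseteq>
        (\<Union>(i, j)\<in>{..<K} \<times> {..<K}. {x \<in> ?X. i < j \<and> (x i, x j) \<in> T})"
    proof
      fix x assume x: "x \<in> {x \<in> ?X. \<not> lev k H (Suc l) x}"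
      then obtain i j where ij: "i < j" "j < K" and no: "\<And>y. insert (x i) (y ` {..<K}) \<in> edges H \<Longrightarrow>
          insert (x j) (y ` {..<K}) \<in> edges H \<Longrightarrow> \<not> lev k H l y"
        unfolding lev.simps K_def by blast
      have "?L (x i) \<inter> ?L (x j) \<subseteq> {y \<in> ?X. \<not> lev k H l y}"
        using no by (auto simp: link_def K_def)
      then have "card (?L (x i) \<inter> ?L (x j)) \<le> card {y \<in> ?X. \<not> lev k H l y}"
        using X by (intro card_mono) auto
      with few have "card (?L (x i) \<inter> ?L (x j)) \<le> \<rho> / 3 * ?m ^ K" by linarith
      moreover have "x i \<in> U" "x j \<in> U" using x ij by auto
      ultimately have "(x i, x j) \<in> T" by (simp add: T_def)
      with x ij show "x \<in> (\<Union>(i, j)\<in>{..<K} \<times> {..<K}. {x \<in> ?X. i < j \<and> (x i, x j) \<in> T})"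
        by auto
    qed
    then have "card {x \<in> ?X. \<not> lev k H (Suc l) x} \<le>
        card (\<Union>p\<in>{..<K} \<times> {..<K}. {x \<in> ?X. fst p < snd p \<and> (x (fst p), x (snd p)) \<in> T})"
      using X by (intro card_mono) (auto simp: case_prod_beta)
    also have "\<dots> \<le> (\<Sum>p\<in>{..<K} \<times> {..<K}. card {x \<in> ?X. fst p < snd p \<and> (x (fst p), x (snd p)) \<in> T})"
      by (intro card_UN_le) simp
    also have "\<dots> \<le> (\<Sum>p\<in>{..<K} \<times> {..<K}. card T * card U ^ (K - 2))"
    proof (rule sum_mono)
      fix p assume "p \<in> {..<K} \<times> {..<K}"
      then show "card {x \<in> ?X. fst p < snd p \<and> (x (fst p), x (snd p)) \<in> T} \<le> card T * card U ^ (K - 2)"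
        using card_tuples_pair_in[OF U(1) TU, of "fst p" "snd p" K] by (cases "fst p < snd p") auto
    qed
    also have "\<dots> = K ^ 2 * card T * card U ^ (K - 2)" by (simp add: power2_eq_square)
    finally have "real (card {x \<in> ?X. \<not> lev k H (Suc l) x}) \<le> real (K ^ 2 * card T * card U ^ (K - 2))"
      by (simp only: of_nat_le_iff)
    with many have "\<gamma> * ?m ^ K < real K ^ 2 * card T * ?m ^ (K - 2)" by simp
    also have "?m ^ K = ?m ^ 2 * ?m ^ (K - 2)" using K by (simp only: power_add[symmetric] le_add_diff_inverse)
    finally have "(\<gamma> * ?m ^ 2) * ?m ^ (K - 2) < (real K ^ 2 * card T) * ?m ^ (K - 2)" by (simp only: mult.assoc)
    then have "\<gamma> * ?m ^ 2 < real K ^ 2 * card T" using m by (simp add: mult_less_cancel_right)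
    then have T: "2 * \<tau> * ?m ^ 2 < card T"
      using K by (simp add: \<tau>_def field_simps)
    have "deep k H n"
    proof (rule deep_if_many_disjoint_links[OF U _ TU \<open>sym T\<close> _ T pos])
      show "(1 / 2 - \<eta>) * ?m ^ (k - 1) \<le> card (?L v)" if "v \<in> U" for v
        using links that by (simp add: K_def)
      show "card (?L u \<inter> ?L v) \<le> \<rho> / 3 * ?m ^ (k - 1)" if "(u, v) \<in> T" for u v
        using that by (simp add: T_def K_def)
      show "\<rho> / 3 \<le> \<rho>" "2 * \<eta> + \<rho> / 3 \<le> \<rho>" using pos by (auto simp: \<eta>_def)
      show "6 * \<rho> < \<tau> ^ (k - 1)" using pos by (simp add: \<rho>_def K_def)
    qed
    with shallow show False by simp
  qed
  ultimately show ?case unfolding K_def by blast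
qed

text \<open>If \<open>H\<close> is not \<open>n\<close>-deep, all tuples over the core fail level
  \<open>n\<close>, whereas \<open>few_tuples_not_lev\<close> with \<open>\<gamma> = 1 / 2\<close>
  allows only half of them to fail.\<close>

lemma deep_if_nearly_half_dense:
  assumes "k \<ge> 3"
  obtains \<eta> :: real where "0 < \<eta>" "\<eta> < 1 / 2" "\<And>H :: 'a hypergraph. kgraph k H \<Longrightarrow>
    (1 / 2 - \<eta>) * (real (card (verts H)) + 1) ^ k < fact k * real (card (edges H)) \<Longrightarrow> deep k H n"
proof -
  have half: "(1 / 2 :: real) > 0" by simp
  obtain \<eta>' :: real where "\<eta>' > 0" and \<eta>': "\<And>(H :: 'a hypergraph) U n'. finite U \<Longrightarrow> U \<noteq> {} \<Longrightarrow>
      (\<forall>v\<in>U. (1 / 2 - \<eta>') * real (card U) ^ (k - 1) \<le> card (link k H U v)) \<Longrightarrow> \<not> deep k H n' \<Longrightarrow>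
      real (card {x \<in> {..<k - 1} \<rightarrow>\<^sub>E U. \<not> lev k H n x}) \<le> 1 / 2 * real (card U) ^ (k - 1)"
    using few_tuples_not_lev[OF assms half, of n] by blast
  \<comment> \<open>The cap 1 / 4 keeps \<open>1 / 2 - \<eta>\<close> positive, as
    \<open>dense_core\<close> asks for a nonnegative constant.\<close>
  define \<eta> where "\<eta> = min \<eta>' (1 / 4)"
  have \<eta>: "0 < \<eta>" "\<eta> < 1 / 2" "\<eta> \<le> \<eta>'" using \<open>\<eta>' > 0\<close> by (auto simp: \<eta>_def)
  have "deep k H n" if H: "kgraph k H"
    "(1 / 2 - \<eta>) * (real (card (verts H)) + 1) ^ k < fact k * real (card (edges H))"
    for H :: "'a hypergraph"
  proof (rule ccontr)
    assume no: "\<not> deep k H n"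
    obtain U where U: "U \<subseteq> verts H" "U \<noteq> {}"
      and links: "\<And>v. v \<in> U \<Longrightarrow> (1 / 2 - \<eta>) * real (card U) ^ (k - 1) < real (card (link k H U v))"
      by (rule dense_core[OF H(1) _ _ H(2)]) (use assms \<eta> in auto)
    have fin: "finite U" using H(1) U(1) finite_subset by (auto simp: kgraph_def)
    have le: "(1 / 2 - \<eta>') * real (card U) ^ (k - 1) \<le> (1 / 2 - \<eta>) * real (card U) ^ (k - 1)"
      using \<eta>(3) by (intro mult_right_mono) auto
    have "\<forall>v\<in>U. (1 / 2 - \<eta>') * real (card U) ^ (k - 1) \<le> card (link k H U v)"
      using le less_imp_le[OF links] by (intro ballI order_trans[OF le])
    from \<eta>'[OF fin U(2) this no]
    have "real (card {x \<in> {..<k - 1} \<rightarrow>\<^sub>E U. \<not> lev k H n x}) \<le> 1 / 2 * real (card U) ^ (k - 1)" .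
    moreover have "{x \<in> {..<k - 1} \<rightarrow>\<^sub>E U. \<not> lev k H n x} = {..<k - 1} \<rightarrow>\<^sub>E U"
      using no by (auto simp: deep_def)
    ultimately have "real (card U) ^ (k - 1) \<le> 1 / 2 * real (card U) ^ (k - 1)"
      by (simp add: card_tuples)
    moreover have "real (card U) ^ (k - 1) > 0" using U(2) fin by (simp add: card_gt_0_iff)
    ultimately show False by linarith
  qed
  then show ?thesis by (rule that[OF \<eta>(1,2)])
qed

section \<open>Supersaturation\<close>

text \<open>The quotient is the product of the factors (n - i) / n over \<open>i < k\<close>, each
  of which tends to 1.\<close>

lemma binomial_over_power_tendsto:
  "(\<lambda>n. real (n choose k) * fact k / real n ^ k) \<longlonglongrightarrow> 1"
proof -
  have "(\<lambda>n. \<Prod>i<k. (real n - real i) / real n) \<longlonglongrightarrow> (\<Prod>i<k. 1)"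
  proof (rule tendsto_prod)
    fix i
    have "(\<lambda>n. 1 - real i * (1 / real n)) \<longlonglongrightarrow> 1 - real i * 0"
      by (intro tendsto_intros lim_1_over_n)
    moreover have "\<forall>\<^sub>F n in sequentially. 1 - real i * (1 / real n) = (real n - real i) / real n"
      using eventually_gt_at_top[of 0] by eventually_elim (simp add: field_simps)
    ultimately show "(\<lambda>n. (real n - real i) / real n) \<longlonglongrightarrow> 1"
      by (simp add: tendsto_cong)
  qed
  moreover have "(\<Prod>i<k. (real n - real i) / real n) = real (n choose k) * fact k / real n ^ k" for n
    by (simp add: prod_dividef binomial_gbinomial gbinomial_prod_rev atLeast0LessThan)
  ultimately show ?thesis by simp
qed

section \<open>Blow-ups in dense hosts\<close>

lemma injective_choice:
  assumes "finite V" "card V \<le> s" "\<And>v. v \<in> V \<Longrightarrow> s \<le> card (S v) \<and> finite (S v)"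
  shows "\<exists>g. inj_on g V \<and> (\<forall>v\<in>V. g v \<in> S v)"
  using assms
proof (induction V rule: finite_induct)
  case (insert v V)
  then obtain g where g: "inj_on g V" "\<forall>v\<in>V. g v \<in> S v" by auto
  have "card (g ` V) < card (S v)"
    using insert.hyps insert.prems(1) insert.prems(2)[of v] card_image[OF g(1)] by simp
  then obtain a where a: "a \<in> S v" "a \<notin> g ` V"
    using insert.hyps(1) by (meson card_mono finite_imageI not_le subsetI)
  have "inj_on (g(v := a)) (insert v V) \<and> (\<forall>u\<in>insert v V. (g(v := a)) u \<in> S u)"
    using g a insert.hyps(2) by (auto simp: inj_on_def)
  then show ?case by blast
qed simp

text \<open>Erdos' theorem on complete multipartite subhypergraphs.\<close>

lemma box_in_dense_PiE:
  fixes c :: real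
  assumes "finite I" "c > 0"
  shows "\<exists>n\<^sub>0. \<forall>(V :: 'a set) \<Phi>. finite V \<longrightarrow> n\<^sub>0 \<le> card V \<longrightarrow> \<Phi> \<subseteq> I \<rightarrow>\<^sub>E V \<longrightarrow>
    c * real (card V) ^ card I \<le> card \<Phi> \<longrightarrow>
    (\<exists>S. (\<forall>i\<in>I. S i \<subseteq> V \<and> s \<le> card (S i)) \<and> Pi\<^sub>E I S \<subseteq> \<Phi>)"
  using assms
proof (induction I arbitrary: c rule: finite_induct)
  case empty
  show ?case
  proof (intro exI[of _ 0] allI impI)
    fix V :: "'a set" and \<Phi> :: "('b \<Rightarrow> 'a) set"
    assume *: "\<Phi> \<subseteq> {} \<rightarrow>\<^sub>E V" "c * real (card V) ^ card {} \<le> card \<Phi>"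
    then have "\<Phi> \<noteq> {}" using empty by auto
    with *(1) show "\<exists>S. (\<forall>i\<in>{}. S i \<subseteq> V \<and> s \<le> card (S i)) \<and> Pi\<^sub>E {} S \<subseteq> \<Phi>" by auto
  qed
next
  case (insert i I)
  \<comment> \<open>With \<open>w\<close> values whose fibres have density \<open>c / 2\<close>, a
    tuple has on average at least \<open>w * c / 2 \<ge> 2 * s\<close> extensions, so the tuples
    with fewer than \<open>s\<close> can be neglected.\<close>
  define w where "w = nat \<lceil>4 * real s / c\<rceil> + 1"
  have w: "4 * real s \<le> real w * c" "w > 0"
  proof -
    have "4 * real s / c \<le> real w" unfolding w_def by linarith
    then show "4 * real s \<le> real w * c" using insert.prems by (simp add: field_simps)
  qed (simp add: w_def)
  \<comment> \<open>At least a proportion \<open>c / 4\<close> of the tuples will be rich, and the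
    pigeonhole over the \<open>2 ^ w\<close> subsets of \<open>W\<close> costs the other
    factor.\<close>
  define c' where "c' = c / (4 * 2 ^ w)"
  have "c' > 0" using insert.prems by (simp add: c'_def)
  from insert.IH[OF this] obtain n\<^sub>0 where "\<forall>(V :: 'a set) \<Phi>. finite V \<longrightarrow> n\<^sub>0 \<le> card V \<longrightarrow>
      \<Phi> \<subseteq> I \<rightarrow>\<^sub>E V \<longrightarrow> c' * real (card V) ^ card I \<le> card \<Phi> \<longrightarrow>
      (\<exists>S. (\<forall>i\<in>I. S i \<subseteq> V \<and> s \<le> card (S i)) \<and> Pi\<^sub>E I S \<subseteq> \<Phi>)" by (rule exE)
  note IH = this[rule_format]
  define n\<^sub>1 where "n\<^sub>1 = n\<^sub>0 + nat \<lceil>2 * real w / c\<rceil> + 1"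
  have "\<exists>S. (\<forall>j\<in>insert i I. S j \<subseteq> V \<and> s \<le> card (S j)) \<and> Pi\<^sub>E (insert i I) S \<subseteq> \<Phi>"
    if V: "finite V" "n\<^sub>1 \<le> card V" and \<Phi>: "\<Phi> \<subseteq> insert i I \<rightarrow>\<^sub>E V"
      "c * real (card V) ^ card (insert i I) \<le> card \<Phi>"
    for V :: "'a set" and \<Phi>
  proof -
    let ?X = "I \<rightarrow>\<^sub>E V" and ?m = "real (card V)"
    define N where "N = real (card V) ^ card I"
    define F where "F = (\<lambda>v. {x \<in> ?X. x(i := v) \<in> \<Phi>})"
    have X: "finite ?X" "real (card ?X) = N"
      using V(1) insert.hyps(1) by (auto simp: N_def card_funcsetE intro!: finite_PiE)
    have m: "?m > 0" "n\<^sub>0 \<le> card V" "2 * real w \<le> c * ?m"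
    proof -
      have "2 * real w / c \<le> ?m" using V(2) unfolding n\<^sub>1_def by linarith
      then show "2 * real w \<le> c * ?m" using insert.prems by (simp add: field_simps)
    qed (use V(2) in \<open>auto simp: n\<^sub>1_def\<close>)
    have N: "N > 0" using m by (simp add: N_def)
    have F: "F v \<subseteq> ?X" "finite (F v)" for v using X(1) by (auto simp: F_def)
    have FN: "real (card (F v)) \<le> N" for v
      using card_mono[OF X(1) F(1)[of v]] X(2) by linarith
    have "\<Phi> \<subseteq> (\<Union>v\<in>V. (\<lambda>x. x(i := v)) ` F v)"
    proof
      fix y assume y: "y \<in> \<Phi>"
      then have "y \<in> insert i I \<rightarrow>\<^sub>E V" using \<Phi>(1) by blast
      then have "y(i := undefined) \<in> ?X" "y i \<in> V"
        using fun_upd_in_PiE[OF insert.hyps(2)] by auto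
      then have "y(i := undefined) \<in> F (y i)" using y by (simp add: F_def)
      then have "(y(i := undefined))(i := y i) \<in> (\<lambda>x. x(i := y i)) ` F (y i)" by (rule imageI)
      then show "y \<in> (\<Union>v\<in>V. (\<lambda>x. x(i := v)) ` F v)" using \<open>y i \<in> V\<close> by auto
    qed
    then have "card \<Phi> \<le> card (\<Union>v\<in>V. (\<lambda>x. x(i := v)) ` F v)"
      using V(1) F(2) by (intro card_mono) auto
    also have "\<dots> \<le> (\<Sum>v\<in>V. card ((\<lambda>x. x(i := v)) ` F v))"
      by (rule card_UN_le[OF V(1)])
    also have "\<dots> \<le> (\<Sum>v\<in>V. card (F v))" by (intro sum_mono card_image_le F(2))
    finally have "real (card \<Phi>) \<le> (\<Sum>v\<in>V. real (card (F v)))"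
      by (simp only: of_nat_sum[symmetric] of_nat_le_iff)
    moreover have "c * real (card V) ^ card (insert i I) = c * ?m * N"
      using insert.hyps by (simp add: N_def)
    ultimately have sumF: "c * ?m * N \<le> (\<Sum>v\<in>V. real (card (F v)))" using \<Phi>(2) by linarith
    \<comment> \<open>Values of coordinate \<open>i\<close> with a dense fibre. As no fibre exceeds
      \<open>N\<close>, at least \<open>c / 2 * ?m\<close> values qualify.\<close>
    define Big where "Big = {v \<in> V. c / 2 * N \<le> card (F v)}"
    have Big: "finite Big" "Big \<subseteq> V" using V(1) by (auto simp: Big_def)
    have "(\<Sum>v\<in>V. real (card (F v))) \<le> (\<Sum>v\<in>V. (if v \<in> Big then N else 0) + c / 2 * N)"
      using FN insert.prems N by (intro sum_mono) (auto simp: Big_def intro: add_increasing2)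
    also have "\<dots> = real (card Big) * N + ?m * (c / 2 * N)"
      using V(1) Big(2) by (simp add: sum.distrib sum.If_cases Int_absorb1)
    finally have "c / 2 * ?m * N \<le> real (card Big) * N" using sumF by (simp add: algebra_simps)
    then have "c / 2 * ?m \<le> real (card Big)" using N by simp
    then have "w \<le> card Big" using m(3) by linarith
    then obtain W where W: "W \<subseteq> Big" "card W = w" "finite W"
      using obtain_subset_with_card_n by metis
    \<comment> \<open>\<open>D x\<close> collects the values in \<open>W\<close> that extend
      \<open>x\<close> to an element of \<open>\<Phi>\<close>; tuples with equal \<open>D x\<close>
      can share this set as one side of the box.\<close>
    define D where "D = (\<lambda>x. {v \<in> W. x \<in> F v})"
    have DW: "D x \<subseteq> W" "finite (D x)" "card (D x) \<le> w" for x
      using W(2,3) card_mono[OF W(3), of "D x"] by (auto simp: D_def)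
    define Rich where "Rich = {x \<in> ?X. s \<le> card (D x)}"
    have Rich: "finite Rich" "Rich \<subseteq> ?X" using X(1) by (auto simp: Rich_def)
    have "real w * (c / 2 * N) = (\<Sum>v\<in>W. c / 2 * N)" using W(2) by simp
    also have "\<dots> \<le> (\<Sum>v\<in>W. real (card (F v)))"
      using W(1) by (intro sum_mono) (auto simp: Big_def)
    also have "\<dots> = real (\<Sum>v\<in>W. card {x \<in> ?X. x \<in> F v})"
      unfolding of_nat_sum by (intro sum.cong refl arg_cong[of _ _ "\<lambda>A. real (card A)"]) (use F(1) in auto)
    also have "(\<Sum>v\<in>W. card {x \<in> ?X. x \<in> F v}) = (\<Sum>x\<in>?X. card (D x))"
      unfolding D_def using W(3) X(1) by (intro sum_multicount_gen) auto
    also have "real (\<Sum>x\<in>?X. card (D x)) \<le> (\<Sum>x\<in>?X. (if x \<in> Rich then real w else 0) + real s)"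
      unfolding of_nat_sum using DW(3) by (intro sum_mono) (auto simp: Rich_def intro: add_increasing2)
    also have "\<dots> = real (card Rich) * w + N * s"
      using X Rich(2) by (simp add: sum.distrib sum.If_cases Int_absorb1)
    finally have "real w * (c / 2 * N) \<le> real (card Rich) * w + N * s" .
    moreover have "N * (4 * s) \<le> N * (real w * c)" using w(1) N by (intro mult_left_mono) auto
    ultimately have "real w * (c / 4 * N) \<le> real w * real (card Rich)"
      by (simp add: algebra_simps)
    then have large: "c / 4 * N \<le> real (card Rich)" using w(2) by simp
    obtain Y where "Y \<in> Pow W" and Y2: "card Rich \<le> card (D -` {Y} \<inter> Rich) * card (Pow W)"
      using pigeonhole_card[of D Rich "Pow W"] DW(1) Rich(1) W(3) by auto
    moreover have "D -` {Y} \<inter> Rich = {x \<in> Rich. D x = Y}" by auto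
    ultimately have Y: "Y \<subseteq> W" "card Rich \<le> 2 ^ w * card {x \<in> Rich. D x = Y}"
      using W(2,3) by (auto simp: card_Pow mult.commute)
    let ?\<Psi> = "{x \<in> Rich. D x = Y}"
    have "real (card Rich) \<le> 2 ^ w * real (card ?\<Psi>)"
      using of_nat_mono[OF Y(2), where 'a = real] by simp
    with large have \<Psi>: "c' * N \<le> card ?\<Psi>" by (simp add: c'_def field_simps)
    have "0 < c' * N" using \<open>c' > 0\<close> N by simp
    with \<Psi> have "card ?\<Psi> \<noteq> 0" by linarith
    then have "?\<Psi> \<noteq> {}" by (metis card.empty)
    then have "s \<le> card Y" by (auto simp: Rich_def)
    have "?\<Psi> \<subseteq> ?X" using Rich(2) by blast
    from IH[OF V(1) m(2) this \<Psi>[unfolded N_def]]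
    obtain S where S: "\<forall>j\<in>I. S j \<subseteq> V \<and> s \<le> card (S j)" "Pi\<^sub>E I S \<subseteq> ?\<Psi>"
      by (elim exE conjE)
    \<comment> \<open>A box inside the tuples with \<open>D x = Y\<close> becomes a box in
      \<open>\<Phi>\<close> with \<open>Y\<close> as the side for \<open>i\<close>.\<close>
    have "Pi\<^sub>E (insert i I) (S(i := Y)) \<subseteq> \<Phi>"
    proof
      fix y assume y: "y \<in> Pi\<^sub>E (insert i I) (S(i := Y))"
      then have "y(i := undefined) \<in> Pi\<^sub>E I (S(i := Y))" "y i \<in> Y"
        using fun_upd_in_PiE[OF insert.hyps(2)] PiE_mem[OF y, of i] by auto
      moreover have "Pi\<^sub>E I (S(i := Y)) = Pi\<^sub>E I S"
        using insert.hyps(2) by (intro PiE_cong) auto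
      ultimately have "D (y(i := undefined)) = Y" using S(2) by auto
      with \<open>y i \<in> Y\<close> have "y(i := undefined) \<in> F (y i)" by (auto simp: D_def)
      then show "y \<in> \<Phi>" by (simp add: F_def)
    qed
    moreover have "\<forall>j\<in>insert i I. (S(i := Y)) j \<subseteq> V \<and> s \<le> card ((S(i := Y)) j)"
      using S(1) Y(1) W(1) Big(2) \<open>s \<le> card Y\<close> by auto
    ultimately show ?thesis by (intro exI[of _ "S(i := Y)"] conjI)
  qed
  then show ?case by (intro exI[of _ n\<^sub>1] allI impI)
qed

text \<open>A dense host has many vertex maps from \<open>{..<M}\<close> whose pullback is dense, hence many with one
  and the same pullback \<open>C\<close>; a box of such maps is a blow-up of \<open>C\<close>, into which \<open>G\<close> embeds.\<close>

lemma dense_contains_copy: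
  fixes G :: "'a hypergraph" and \<theta> d :: real
  assumes G: "kgraph k G" and "k \<le> M" "0 \<le> \<theta>" "\<theta> < d * fact k * real (M choose k)"
    and "k \<ge> 1" and hom: "\<And>C :: nat hypergraph. kgraph k C \<Longrightarrow> verts C = {..<M} \<Longrightarrow>
      \<theta> < fact k * real (card (edges C)) \<Longrightarrow> \<exists>f. is_hom f G C"
  shows "\<exists>n\<^sub>0. \<forall>H :: nat hypergraph. kgraph k H \<longrightarrow> n\<^sub>0 \<le> card (verts H) \<longrightarrow>
    d * real (card (verts H)) ^ k \<le> fact k * real (card (edges H)) \<longrightarrow> contains_copy H G"
proof -
  define q where "q = real (M choose k)"
  define \<theta>' where "\<theta>' = \<theta> / fact k"
  \<comment> \<open>A bad map has pullback density at most \<open>\<theta>' / q\<close> while the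
    mean is at least \<open>d\<close>, so a proportion \<open>\<kappa>\<close> of all maps is good.
    The divisor \<open>2 ^ 2 ^ M\<close> is the number of set systems on
    \<open>{..<M}\<close>.\<close>
  define \<kappa> where "\<kappa> = d - \<theta>' / q"
  define c where "c = \<kappa> / 2 ^ 2 ^ M"
  have q: "q > 0" using assms(2) by (simp add: q_def zero_less_binomial_iff)
  have "\<theta>' < d * q"
    using assms(4) by (simp add: \<theta>'_def q_def field_simps)
  then have "\<kappa> > 0" using q by (simp add: \<kappa>_def field_simps)
  then have "c > 0" by (simp add: c_def)
  from box_in_dense_PiE[OF finite_lessThan this, of M "card (verts G)"] obtain n\<^sub>0 where
    "\<forall>(V :: nat set) \<Phi>. finite V \<longrightarrow> n\<^sub>0 \<le> card V \<longrightarrow> \<Phi> \<subseteq> {..<M} \<rightarrow>\<^sub>E V \<longrightarrow>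
      c * real (card V) ^ card {..<M} \<le> card \<Phi> \<longrightarrow>
      (\<exists>S. (\<forall>i\<in>{..<M}. S i \<subseteq> V \<and> card (verts G) \<le> card (S i)) \<and> Pi\<^sub>E {..<M} S \<subseteq> \<Phi>)"
    by (elim exE)
  note box = this[rule_format]
  have "contains_copy H G" if H: "kgraph k H" "n\<^sub>0 + 1 \<le> card (verts H)"
      "d * real (card (verts H)) ^ k \<le> fact k * real (card (edges H))" for H :: "nat hypergraph"
  proof -
    let ?V = "verts H" and ?n = "real (card (verts H))" and ?p = "\<lambda>x. pullback k {..<M} x H"
    let ?X = "{..<M} \<rightarrow>\<^sub>E ?V"
    have V: "finite ?V" using H(1) by (simp add: kgraph_def)
    have n: "?n > 0" using H(2) by simp
    have X: "finite ?X" "real (card ?X) = ?n ^ M"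
      using V by (auto simp: card_funcsetE intro!: finite_PiE)
    define Good where "Good = {x \<in> ?X. \<theta>' < card (edges (?p x))}"
    have Good: "finite Good" "Good \<subseteq> ?X" using X(1) by (auto simp: Good_def)
    have le_q: "real (card (edges (?p x))) \<le> q" for x
      using card_edges_le[OF kgraph_pullback[of "{..<M}" k x H]] by (simp add: q_def pullback_def)
    have "q * (d * ?n ^ M) = q * (d * ?n ^ k * ?n ^ (M - k))"
      using assms(2) by (simp flip: power_add)
    also have "\<dots> \<le> q * (fact k * real (card (edges H)) * ?n ^ (M - k))"
      using q H(3) by (intro mult_left_mono mult_right_mono) auto
    also have "\<dots> = real (\<Sum>x\<in>?X. card (edges (?p x)))"
      using sum_card_edges_pullback[of "{..<M}", OF _ H(1)] by (simp add: q_def)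
    also have "\<dots> \<le> (\<Sum>x\<in>?X. (if x \<in> Good then q else 0) + \<theta>')"
      unfolding of_nat_sum using le_q assms(3)
      by (intro sum_mono) (auto simp: Good_def \<theta>'_def intro: add_increasing2)
    also have "\<dots> = real (card Good) * q + ?n ^ M * \<theta>'"
      using X Good(2) by (simp add: sum.distrib sum.If_cases Int_absorb1)
    finally have "q * (d * ?n ^ M) \<le> real (card Good) * q + ?n ^ M * \<theta>'" .
    moreover have "q * (\<kappa> * ?n ^ M) = q * (d * ?n ^ M) - ?n ^ M * \<theta>'"
    proof -
      have "q * \<kappa> = q * d - \<theta>'" using q by (simp add: \<kappa>_def right_diff_distrib)
      then have "(q * \<kappa>) * ?n ^ M = (q * d - \<theta>') * ?n ^ M" by (simp only:)
      then show ?thesis by (simp add: algebra_simps)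
    qed
    ultimately have "q * (\<kappa> * ?n ^ M) \<le> q * real (card Good)"
      by (simp add: mult.commute)
    then have many: "\<kappa> * ?n ^ M \<le> real (card Good)" using q by simp
    let ?E = "Pow (Pow {..<M})"
    have E: "(\<lambda>x. edges (?p x)) \<in> Good \<rightarrow> ?E" "finite ?E" "?E \<noteq> {}"
      by (auto simp: pullback_def)
    from pigeonhole_card[OF E(1) Good(1) E(2,3)] obtain D where
      D: "card Good \<le> card ((\<lambda>x. edges (?p x)) -` {D} \<inter> Good) * card ?E" by (elim bexE)
    define \<Phi> where "\<Phi> = {x \<in> Good. edges (?p x) = D}"
    have "(\<lambda>x. edges (?p x)) -` {D} \<inter> Good = \<Phi>" by (auto simp: \<Phi>_def)
    with D have "card Good \<le> card \<Phi> * 2 ^ 2 ^ M" by (simp add: card_Pow)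
    from of_nat_mono[OF this, where 'a = real]
    have "c * ?n ^ card {..<M} \<le> card \<Phi>"
      using many by (simp add: c_def field_simps)
    moreover have "\<Phi> \<subseteq> ?X" using Good(2) by (auto simp: \<Phi>_def)
    ultimately obtain S where S': "\<forall>i\<in>{..<M}. S i \<subseteq> ?V \<and> card (verts G) \<le> card (S i)"
        "Pi\<^sub>E {..<M} S \<subseteq> \<Phi>"
      using box[OF V, of \<Phi>] H(2) by auto
    then have S: "\<And>i. i < M \<Longrightarrow> S i \<subseteq> ?V \<and> card (verts G) \<le> card (S i)" "Pi\<^sub>E {..<M} S \<subseteq> \<Phi>"
      by auto
    have "0 < c * ?n ^ card {..<M}" using \<open>c > 0\<close> n by simp
    with \<open>c * ?n ^ card {..<M} \<le> card \<Phi>\<close> have "card \<Phi> \<noteq> 0" by linarith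
    then have "\<Phi> \<noteq> {}" by (metis card.empty)
    then obtain x\<^sub>0 where x0: "x\<^sub>0 \<in> \<Phi>" by blast
    then have "x\<^sub>0 \<in> Good" by (simp add: \<Phi>_def)
    then have "\<theta> < fact k * real (card (edges (?p x\<^sub>0)))"
      by (simp add: Good_def \<theta>'_def field_simps)
    moreover have "verts (?p x\<^sub>0) = {..<M}" by (simp add: pullback_def)
    ultimately obtain h where h: "is_hom h G (?p x\<^sub>0)"
      using hom[OF kgraph_pullback[OF finite_lessThan]] by blast
    have hM: "h v < M" if "v \<in> verts G" for v
      using h that by (auto simp: is_hom_def pullback_def)
    have "finite (verts G)" using G by (simp add: kgraph_def)
    have lists: "card (verts G) \<le> card (S (h v)) \<and> finite (S (h v))" if "v \<in> verts G" for v
      using S(1)[OF hM[OF that]] V finite_subset by auto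
    \<comment> \<open>Vertices of \<open>G\<close> that \<open>h\<close> identifies get distinct
      representatives from the same part, which turns the homomorphism into an embedding.\<close>
    have "\<exists>g. inj_on g (verts G) \<and> (\<forall>v\<in>verts G. g v \<in> S (h v))"
      by (rule injective_choice[OF \<open>finite (verts G)\<close> order_refl]) (rule lists)
    then obtain g where g: "inj_on g (verts G)" "\<And>v. v \<in> verts G \<Longrightarrow> g v \<in> S (h v)"
      by blast
    have S_ne: "S i \<noteq> {}" if "verts G \<noteq> {}" "i < M" for i
      using S(1)[OF that(2)] that(1) \<open>finite (verts G)\<close> by (auto simp: card_gt_0_iff)
    have "g ` e \<in> edges H" if e: "e \<in> edges G" for e
    proof -
      have eG: "e \<subseteq> verts G" "card e = k" using kgraph_edgeD[OF G e] by auto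
      have "h ` e \<in> edges (?p x\<^sub>0)" using h e by (simp add: is_hom_def)
      then have hD: "h ` e \<in> D" and "card (h ` e) = k" using x0 by (auto simp: \<Phi>_def pullback_def)
      then have inj: "inj_on h e"
        using eG finite_subset[OF eG(1) \<open>finite (verts G)\<close>] by (intro eq_card_imp_inj_on) simp_all
      \<comment> \<open>As \<open>h\<close> is injective on \<open>e\<close>, the values of
        \<open>g\<close> on \<open>e\<close> prescribe coordinates of a tuple. Filling the others
        arbitrarily gives a map in the box, and all of these have the same pullback edge set
        \<open>D\<close>.\<close>
      define x where "x = (\<lambda>i. if i \<in> h ` e then g (the_inv_into e h i)
        else if i < M then (SOME a. a \<in> S i) else undefined)"
      have "x \<in> Pi\<^sub>E {..<M} S"
      proof (rule PiE_I)
        fix i assume i: "i \<in> {..<M}"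
        show "x i \<in> S i"
        proof (cases "i \<in> h ` e")
          case True
          then obtain v where "v \<in> e" "i = h v" by blast
          then show ?thesis using g(2) eG(1) inj by (auto simp: x_def the_inv_into_f_f)
        next
          case False
          have "verts G \<noteq> {}" using eG assms(2) \<open>k \<ge> 1\<close> by auto
          with S_ne i have "S i \<noteq> {}" by auto
          then show ?thesis using False i by (auto simp: x_def some_in_eq)
        qed
      next
        fix i assume "i \<notin> {..<M}"
        moreover have "h ` e \<subseteq> {..<M}" using hM eG(1) by auto
        ultimately show "x i = undefined" by (auto simp: x_def)
      qed
      then have "edges (?p x) = D" using S(2) by (auto simp: \<Phi>_def)
      with hD have "x ` h ` e \<in> edges H" by (auto simp: pullback_def)
      moreover have "x ` h ` e = g ` e"
        unfolding image_image using inj by (intro image_cong) (auto simp: x_def the_inv_into_f_f)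
      ultimately show ?thesis by simp
    qed
    moreover have "g ` verts G \<subseteq> ?V" using g(2) S(1) hM by blast
    ultimately show ?thesis using g(1) by (auto simp: contains_copy_def)
  qed
  then show ?thesis by (intro exI[of _ "n\<^sub>0 + 1"] allI impI)
qed

section \<open>Turan densities of the constructed hypergraphs\<close>

lemma turan_density_limit:
  "edges G \<noteq> {} \<Longrightarrow> ex_ratio k {G} \<longlonglongrightarrow> turan_density k G"
  unfolding turan_density_def by (rule turan_density_family_limit) auto

text \<open>A large host free of \<open>G\<close> has fewer than \<open>d * n ^ k / fact k\<close>
  edges; divided by the binomial coefficient this tends to \<open>d\<close>.\<close>

lemma turan_density_le:
  fixes G :: "'a hypergraph"
  assumes "edges G \<noteq> {}"
    and copy: "\<And>H :: nat hypergraph. kgraph k H \<Longrightarrow> n\<^sub>0 \<le> card (verts H) \<Longrightarrow>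
      d * real (card (verts H)) ^ k \<le> fact k * real (card (edges H)) \<Longrightarrow> contains_copy H G"
  shows "turan_density k G \<le> d"
proof (rule tendsto_le[OF sequentially_bot _ turan_density_limit[OF assms(1)]])
  let ?b = "\<lambda>n. real (n choose k) * fact k / real n ^ k"
  have "(\<lambda>n. d / ?b n) \<longlonglongrightarrow> d / 1"
    by (intro tendsto_divide tendsto_const binomial_over_power_tendsto) simp
  then show "(\<lambda>n. d / ?b n) \<longlonglongrightarrow> d" by simp
  show "\<forall>\<^sub>F n in sequentially. ex_ratio k {G} n \<le> d / ?b n"
    using eventually_ge_at_top[of "n\<^sub>0 + k + 1"]
  proof eventually_elim
    case (elim n)
    obtain H :: "nat hypergraph" where H: "kgraph k H" "card (verts H) = n"
      "\<not> contains_copy H G" "card (edges H) = ex_family k n {G}"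
      using ex_family_attained[of "{G}" k n] assms(1) by auto
    have "\<not> d * real n ^ k \<le> fact k * real (ex_family k n {G})"
      using copy[OF H(1)] H(3) elim unfolding H(2,4) by linarith
    then have "fact k * real (ex_family k n {G}) \<le> d * real n ^ k" by simp
    moreover have "real (n choose k) > 0" using elim by (simp add: zero_less_binomial_iff)
    ultimately show ?case by (simp add: field_simps)
  qed
qed

text \<open>Divided by \<open>M ^ k\<close>, the two sides tend to \<open>c\<close> and
  \<open>d\<close>, so any large \<open>M\<close> works.\<close>

lemma power_less_binomial:
  fixes c d :: real
  assumes "c < d"
  obtains M where "k \<le> M" "c * (real M + 1) ^ k < d * fact k * real (M choose k)"
proof -
  let ?f = "\<lambda>M. d * (real (M choose k) * fact k / real M ^ k) - c * (1 + 1 / real M) ^ k"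
  have "?f \<longlonglongrightarrow> d * 1 - c * (1 + 0) ^ k"
    by (intro tendsto_intros binomial_over_power_tendsto lim_1_over_n)
  then have "?f \<longlonglongrightarrow> d - c" by simp
  then have "\<forall>\<^sub>F M in sequentially. 0 < ?f M" using assms by (intro order_tendstoD) auto
  then have "\<forall>\<^sub>F M in sequentially. 0 < ?f M \<and> k + 1 \<le> M"
    using eventually_ge_at_top[of "k + 1"] by eventually_elim simp
  from eventually_happens'[OF sequentially_bot this] obtain M where M: "0 < ?f M" "k + 1 \<le> M"
    by (elim exE conjE)
  have "1 + 1 / real M = (real M + 1) / real M" using M(2) by (simp add: field_simps)
  then have "c * ((real M + 1) ^ k / real M ^ k) < d * (real (M choose k) * fact k / real M ^ k)"
    using M(1) by (simp add: power_divide)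
  then have "c * (real M + 1) ^ k < d * fact k * real (M choose k)"
    using M(2) by (simp add: field_simps)
  then show ?thesis by (intro that[of M]) (use M(2) in auto)
qed

text \<open>\<open>G\<close> is the product of all \<open>k\<close>-graphs on \<open>M\<close>
  vertices above the threshold given by \<open>c\<close>. The depth clause treats each
  \<open>n\<close> separately: it yields one prescribed depth when \<open>c < 1 / 2\<close> and all
  depths when \<open>c = 1 / 2\<close>.\<close>

lemma deep_graph_with_small_density:
  fixes c d :: real
  assumes "k \<ge> 3" "0 \<le> c" "c < d" "d \<le> 1"
  shows "\<exists>G :: nat hypergraph. kgraph k G \<and> (edges G \<noteq> {} \<longrightarrow> turan_density k G \<le> d) \<and>
    (\<forall>n. (\<forall>C :: nat hypergraph. kgraph k C \<longrightarrow>
        c * (real (card (verts C)) + 1) ^ k < fact k * real (card (edges C)) \<longrightarrow> deep k C n) \<longrightarrow>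
      deep k G n)"
proof -
  obtain M where M: "k \<le> M" "c * (real M + 1) ^ k < d * fact k * real (M choose k)"
    using power_less_binomial[OF assms(3)] by blast
  define \<C> :: "nat hypergraph set" where
    "\<C> = {C. kgraph k C \<and> verts C = {..<M} \<and> c * (real M + 1) ^ k < fact k * real (card (edges C))}"
  have "\<C> \<subseteq> Hypergraph {..<M} ` Pow (Pow {..<M})"
  proof
    fix C assume C: "C \<in> \<C>"
    then have "C = Hypergraph {..<M} (edges C)" by (cases C) (auto simp: \<C>_def)
    moreover have "e \<subseteq> {..<M}" if "e \<in> edges C" for e
      using kgraph_edgeD[of k C e] that C by (simp add: \<C>_def)
    then have "edges C \<in> Pow (Pow {..<M})" by blast
    ultimately show "C \<in> Hypergraph {..<M} ` Pow (Pow {..<M})" by blast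
  qed
  then have fin: "finite \<C>" by (rule finite_subset) simp
  \<comment> \<open>By \<open>d \<le> 1\<close> the complete \<open>k\<close>-graph on
    \<open>M\<close> vertices belongs to the family, so the product has a factor.\<close>
  have "c * (real M + 1) ^ k < 1 * fact k * real (M choose k)"
    by (rule less_le_trans[OF M(2)], intro mult_right_mono assms(4)) auto
  then have "Hypergraph {..<M} {e. e \<subseteq> {..<M} \<and> card e = k} \<in> \<C>"
    by (simp add: \<C>_def kgraph_def n_subsets)
  then have "\<C> \<noteq> {}" by blast
  have \<C>: "kgraph k C" if "C \<in> \<C>" for C using that by (simp add: \<C>_def)
  have "1 \<le> k" using assms(1) by simp
  have "\<exists>G :: nat hypergraph. kgraph k G \<and> (\<forall>C\<in>\<C>. \<exists>f. is_hom f G C) \<and>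
      (\<forall>n. (\<forall>C\<in>\<C>. deep k C n) \<longrightarrow> deep k G n)"
    by (rule common_hom_source[OF fin \<open>\<C> \<noteq> {}\<close> \<open>1 \<le> k\<close>]) (rule \<C>)
  then obtain G :: "nat hypergraph" where
    G: "kgraph k G" "\<forall>C\<in>\<C>. \<exists>f. is_hom f G C" "\<forall>n. (\<forall>C\<in>\<C>. deep k C n) \<longrightarrow> deep k G n"
    by (elim exE conjE)
  have "\<exists>n\<^sub>0. \<forall>H :: nat hypergraph. kgraph k H \<longrightarrow> n\<^sub>0 \<le> card (verts H) \<longrightarrow>
      d * real (card (verts H)) ^ k \<le> fact k * real (card (edges H)) \<longrightarrow> contains_copy H G"
  proof (rule dense_contains_copy[OF G(1) M(1) _ M(2)])
    show "0 \<le> c * (real M + 1) ^ k" "1 \<le> k" using \<open>1 \<le> k\<close> assms(2) by simp_all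
    show "\<exists>f. is_hom f G C" if "kgraph k C" "verts C = {..<M}"
      "c * (real M + 1) ^ k < fact k * real (card (edges C))" for C :: "nat hypergraph"
      using G(2) that by (simp add: \<C>_def)
  qed
  then obtain n\<^sub>0 where "\<forall>H :: nat hypergraph. kgraph k H \<longrightarrow> n\<^sub>0 \<le> card (verts H) \<longrightarrow>
      d * real (card (verts H)) ^ k \<le> fact k * real (card (edges H)) \<longrightarrow> contains_copy H G" ..
  then have density: "edges G \<noteq> {} \<longrightarrow> turan_density k G \<le> d"
    by (intro impI turan_density_le[of G k n\<^sub>0 d]) simp_all
  have deep: "deep k G n" if all: "\<forall>C :: nat hypergraph. kgraph k C \<longrightarrow>
      c * (real (card (verts C)) + 1) ^ k < fact k * real (card (edges C)) \<longrightarrow> deep k C n" for n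
  proof -
    have "deep k C n" if C: "C \<in> \<C>" for C
    proof -
      have "kgraph k C" "c * (real (card (verts C)) + 1) ^ k < fact k * real (card (edges C))"
        using C by (simp_all add: \<C>_def)
      then show ?thesis using all by simp
    qed
    then show ?thesis using G(3) by blast
  qed
  show ?thesis by (intro exI[of _ G] conjI G(1) density allI) (rule impI, rule deep)
qed

lemma turan_density_family_ge_if_deep:
  assumes "k \<ge> 3" "N \<ge> 1" "\<And>F. F \<in> \<F> \<Longrightarrow> deep k F (2 * N + 2)"
  shows "(1 / 2) * (real (N choose k) * fact k / real N ^ k) \<le> turan_density_family k \<F>"
proof (rule LIMSEQ_le_const[OF turan_density_family_limit])
  show "edges F \<noteq> {}" if "F \<in> \<F>" for F
    using deep_imp_edge[of k F "2 * N + 1"] assms(1) assms(3)[OF that] by simp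
  show "\<exists>n\<^sub>0. \<forall>n\<ge>n\<^sub>0. (1 / 2) * (real (N choose k) * fact k / real N ^ k) \<le> ex_ratio k \<F> n"
    using ex_ratio_ge_if_deep[OF assms(1) _ assms(2,3)] by (intro exI[of _ k] allI impI) simp
qed

lemma turan_density_family_ge_half:
  assumes "k \<ge> 3" "\<And>F n. F \<in> \<F> \<Longrightarrow> deep k F n"
  shows "1 / 2 \<le> turan_density_family k \<F>"
proof (rule LIMSEQ_le_const2)
  show "(\<lambda>N. (1 / 2) * (real (N choose k) * fact k / real N ^ k)) \<longlonglongrightarrow> 1 / 2"
    using tendsto_mult_left[OF binomial_over_power_tendsto, of "1 / 2"] by simp
  show "\<exists>N\<^sub>0. \<forall>N\<ge>N\<^sub>0. (1 / 2) * (real (N choose k) * fact k / real N ^ k) \<le> turan_density_family k \<F>"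
    by (intro exI[of _ 1] allI impI turan_density_family_ge_if_deep assms)
qed

lemma turan_density_family_le:
  assumes "G \<in> \<F>" "\<And>F. F \<in> \<F> \<Longrightarrow> edges F \<noteq> {}"
  shows "turan_density_family k \<F> \<le> turan_density k G"
proof (rule LIMSEQ_le[OF turan_density_family_limit[OF assms(2)] turan_density_limit])
  show "edges G \<noteq> {}" using assms by blast
  show "\<exists>N. \<forall>n\<ge>N. ex_ratio k \<F> n \<le> ex_ratio k {G} n"
    using ex_family_mono[of "{G}" \<F> k] assms by (intro exI allI impI divide_right_mono) auto
qed auto

theorem theorem1p2:
  fixes k :: nat
  assumes "k \<ge> 3"
  shows "\<exists>\<alpha>::real. 0 \<le> \<alpha> \<and> \<alpha> < 1 \<and>
    (\<exists>F :: nat \<Rightarrow> nat hypergraph.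
       (\<forall>n\<ge>1. kgraph k (F n)) \<and>
       (\<lambda>n. turan_density k (F n)) \<longlonglongrightarrow> \<alpha> \<and>
       (\<forall>n\<ge>1. turan_density k (F n) < \<alpha>)) \<and>
    (\<exists>G :: real \<Rightarrow> nat hypergraph.
       (\<forall>\<epsilon>>0. kgraph k (G \<epsilon>)) \<and>
       (\<forall>\<epsilon>>0. \<alpha> \<le> turan_density k (G \<epsilon>) \<and> turan_density k (G \<epsilon>) \<le> \<alpha> + \<epsilon>) \<and>
       turan_density_family k {G (1 / real n) | n :: nat. n \<ge> 1} = \<alpha>) \<and>
    \<alpha> \<le> (real k - 2) / (real k - 1) \<and>
    (k = 3 \<longrightarrow> \<alpha> = 1 / 2)"
proof (intro exI[of _ "1 / 2"] conjI)
  have "\<exists>F :: nat hypergraph. kgraph k F \<and> deep k F (Suc n) \<and> turan_density k F < 1 / 2" for n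
  proof -
    obtain \<eta> :: real where \<eta>: "0 < \<eta>" "\<eta> < 1 / 2" "\<And>H :: nat hypergraph. kgraph k H \<Longrightarrow>
      (1 / 2 - \<eta>) * (real (card (verts H)) + 1) ^ k < fact k * real (card (edges H)) \<Longrightarrow> deep k H (Suc n)"
      by (rule deep_if_nearly_half_dense[OF assms, where n = "Suc n"]) (rule that; blast)
    \<comment> \<open>\<open>1 / 2 - \<eta> / 2\<close> lies strictly between the threshold for
      depth and \<open>1 / 2\<close>, leaving room for supersaturation.\<close>
    obtain F :: "nat hypergraph" where F: "kgraph k F"
      "edges F \<noteq> {} \<longrightarrow> turan_density k F \<le> 1 / 2 - \<eta> / 2" "deep k F (Suc n)"
      using deep_graph_with_small_density[OF assms, of "1 / 2 - \<eta>" "1 / 2 - \<eta> / 2"] \<eta> by auto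
    then have "turan_density k F < 1 / 2" using deep_imp_edge[OF F(3) assms] \<eta>(1) by simp
    with F(1,3) show ?thesis by (intro exI[of _ F] conjI)
  qed
  then have "\<forall>n. \<exists>F :: nat hypergraph. kgraph k F \<and> deep k F (Suc n) \<and> turan_density k F < 1 / 2"
    by (rule allI)
  from choice[OF this] obtain F :: "nat \<Rightarrow> nat hypergraph" where
    "\<forall>n. kgraph k (F n) \<and> deep k (F n) (Suc n) \<and> turan_density k (F n) < 1 / 2" ..
  then have F: "kgraph k (F n)" "deep k (F n) (Suc n)" "turan_density k (F n) < 1 / 2" for n
    by simp_all
  have "(\<lambda>n. turan_density k (F n)) \<longlonglongrightarrow> 1 / 2"
  proof (rule order_tendstoI)
    fix a :: real assume "a < 1 / 2"
    moreover have "(\<lambda>N. (1 / 2) * (real (N choose k) * fact k / real N ^ k)) \<longlonglongrightarrow> 1 / 2"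
      using tendsto_mult_left[OF binomial_over_power_tendsto, of "1 / 2"] by simp
    ultimately have "\<forall>\<^sub>F N in sequentially. a < (1 / 2) * (real (N choose k) * fact k / real N ^ k) \<and> N \<ge> 1"
      using eventually_ge_at_top[of "1 :: nat"] by (intro eventually_conj order_tendstoD(1))
    from eventually_happens'[OF sequentially_bot this]
    obtain N :: nat where N: "a < (1 / 2) * (real (N choose k) * fact k / real N ^ k)" "N \<ge> 1"
      by (elim exE conjE)
    \<comment> \<open>From this index on, \<open>F n\<close> is too deep for the ordered graphs on
      \<open>N\<close> vertices, and \<open>N\<close> was chosen so that their blow-ups have density
      above \<open>a\<close>.\<close>
    have "a < turan_density k (F n)" if "n \<ge> 2 * N + 2" for n
    proof -
      have "deep k (F n) (2 * N + 2)" using deep_antimono[OF F(2)] that by simp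
      then show ?thesis
        using less_le_trans[OF N(1) turan_density_family_ge_if_deep[OF assms N(2), of "{F n}"]]
        unfolding turan_density_def by simp
    qed
    then show "\<forall>\<^sub>F n in sequentially. a < turan_density k (F n)"
      by (rule eventually_sequentiallyI)
  next
    fix a :: real assume "1 / 2 < a"
    then show "\<forall>\<^sub>F n in sequentially. turan_density k (F n) < a"
      using F(3) by (intro always_eventually allI) (rule less_trans)
  qed
  then show "\<exists>F :: nat \<Rightarrow> nat hypergraph. (\<forall>n\<ge>1. kgraph k (F n)) \<and>
      (\<lambda>n. turan_density k (F n)) \<longlonglongrightarrow> 1 / 2 \<and> (\<forall>n\<ge>1. turan_density k (F n) < 1 / 2)"
    using F(1,3) by (intro exI[of _ F] conjI allI impI)

  have "\<exists>G :: nat hypergraph. kgraph k G \<and> (\<forall>n. deep k G n) \<and> turan_density k G \<le> 1 / 2 + \<epsilon>"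
    if "\<epsilon> > 0" for \<epsilon> :: real
  proof -
    \<comment> \<open>The minimum keeps the density parameter at most 1.\<close>
    have "(0::real) \<le> 1 / 2" "1 / 2 < 1 / 2 + min \<epsilon> (1 / 2)" "1 / 2 + min \<epsilon> (1 / 2) \<le> 1"
      using that by auto
    from deep_graph_with_small_density[OF assms this] obtain G :: "nat hypergraph" where
      G: "kgraph k G" "edges G \<noteq> {} \<longrightarrow> turan_density k G \<le> 1 / 2 + min \<epsilon> (1 / 2)" and
      deep: "\<forall>n. (\<forall>C :: nat hypergraph. kgraph k C \<longrightarrow>
        1 / 2 * (real (card (verts C)) + 1) ^ k < fact k * real (card (edges C)) \<longrightarrow> deep k C n) \<longrightarrow>
        deep k G n"
      by (elim exE conjE)
    have "k \<ge> 1" using assms by simp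
    then have G3: "deep k G n" for n using deep deep_if_dense[of k] by blast
    have "turan_density k G \<le> 1 / 2 + \<epsilon>" using G(2) deep_imp_edge[OF G3 assms] by simp
    with G(1) G3 show ?thesis by (intro exI[of _ G] conjI allI)
  qed
  then have "\<forall>\<epsilon>\<in>{0<..}. \<exists>G :: nat hypergraph.
      kgraph k G \<and> (\<forall>n. deep k G n) \<and> turan_density k G \<le> 1 / 2 + \<epsilon>"
    by simp
  from bchoice[OF this] obtain G :: "real \<Rightarrow> nat hypergraph" where
    "\<forall>\<epsilon>\<in>{0<..}. kgraph k (G \<epsilon>) \<and> (\<forall>n. deep k (G \<epsilon>) n) \<and> turan_density k (G \<epsilon>) \<le> 1 / 2 + \<epsilon>" ..
  then have G: "kgraph k (G \<epsilon>)" "deep k (G \<epsilon>) n" "turan_density k (G \<epsilon>) \<le> 1 / 2 + \<epsilon>"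
    if "\<epsilon> > 0" for \<epsilon> n
    using that by simp_all
  have G_ge: "1 / 2 \<le> turan_density k (G \<epsilon>)" if "\<epsilon> > 0" for \<epsilon>
    unfolding turan_density_def using G(2)[OF that] by (intro turan_density_family_ge_half assms) auto
  let ?\<G> = "{G (1 / real n) | n :: nat. n \<ge> 1}"
  have deep\<G>: "deep k F n" if "F \<in> ?\<G>" for F n
    using that G(2) by auto
  have ne: "edges F \<noteq> {}" if "F \<in> ?\<G>" for F
    using deep_imp_edge[OF deep\<G>[OF that] assms] .
  have "turan_density_family k ?\<G> \<le> 1 / 2 + 1 / real (Suc n)" for n
  proof -
    have "G (1 / real (Suc n)) \<in> ?\<G>" by (intro CollectI exI[of _ "Suc n"]) simp
    from turan_density_family_le[OF this ne, of k] G(3)[of "1 / real (Suc n)"] show ?thesis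
      by simp
  qed
  moreover have "(\<lambda>n. 1 / 2 + 1 / real (Suc n)) \<longlonglongrightarrow> 1 / 2 + 0"
    by (intro tendsto_intros LIMSEQ_Suc[OF lim_1_over_n])
  ultimately have "turan_density_family k ?\<G> \<le> 1 / 2"
    using LIMSEQ_le_const[of "\<lambda>n. 1 / 2 + 1 / real (Suc n)" "1 / 2"] by simp
  \<comment> \<open>Each member is deep for every \<open>n\<close>, so blow-ups of any ordered graph
    avoid the whole infinite family at once.\<close>
  moreover have "1 / 2 \<le> turan_density_family k ?\<G>"
    using deep\<G> by (intro turan_density_family_ge_half assms)
  ultimately have "turan_density_family k ?\<G> = 1 / 2" by simp
  then show "\<exists>G :: real \<Rightarrow> nat hypergraph. (\<forall>\<epsilon>>0. kgraph k (G \<epsilon>)) \<and>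
       (\<forall>\<epsilon>>0. 1 / 2 \<le> turan_density k (G \<epsilon>) \<and> turan_density k (G \<epsilon>) \<le> 1 / 2 + \<epsilon>) \<and>
       turan_density_family k {G (1 / real n) | n :: nat. n \<ge> 1} = 1 / 2"
    using G(1,3) G_ge by (intro exI[of _ G] conjI allI impI)
  \<comment> \<open>The right side increases with \<open>k\<close> and equals 1 / 2 at
    \<open>k = 3\<close>.\<close>
  show "1 / 2 \<le> (real k - 2) / (real k - 1)"
    using assms by (simp add: field_simps)
qed simp_all

end
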